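(* Transformers (even with two layers) do not admit non-asymptotic length generalization: the length complexity of transformers, viewed as representations of the languages they accept, is not bounded by any computable function, and this holds already for transformers of depth two.
   Context: For integers $p,s$, $\mathbb F=\mathbb F_{p,s}$ is the set of rationals $m\cdot 2^{-s}$ with $m\in\mathbb Z$, $-2^{p-1}\le m<2^{p-1}$; $\mathrm{round}(x)$ is the greatest element of $\mathbb F$ that is $\le x$. A (future-masked) transformer of depth $k$ and dimension $d$ over a finite alphabet $\Sigma$ consists of functions $E:\Sigma\to\mathbb F^d$, $W_Q^{(\ell)},W_K^{(\ell)},W_V^{(\ell)},f^{(\ell)}:\mathbb F^d\to\mathbb F^d$ ($\ell=1,\dots,k$) and $W_{\mathrm{out}}:\mathbb F^d\to\mathbb F$. On input $w$: $h^{(0)}_i=E(w_i)$; for $\ell=1,\dots,k$: $q_i=W_Q^{(\ell)}(h^{(\ell-1)}_i)$, $k_i=W_K^{(\ell)}(h^{(\ell-1)}_i)$, $v_i=W_V^{(\ell)}(h^{(\ell-1)}_i)$, $s_{ij}=q_i\cdot k_j$, $A_i=\sum_{j\le i}\mathrm{round}(\exp(s_{ij}))\,v_j$, $B_i=\sum_{j\le i}\mathrm{round}(\exp(s_{ij}))$ (these sums computed exactly), $c_i=\mathrm{round}(A_i/B_i)$ (or the average of the $v_j$ if $B_i=0$), $h^{(\ell)}_i=f^{(\ell)}(c_i+h^{(\ell-1)}_i)$; finally $T(w)=W_{\mathrm{out}}(h^{(k)}_{|w|})$, and $T$ accepts $w$ iff $T(w)>0$. The size of a transformer is measured with constants in binary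 and precision in unary. The length complexity is $f(c)=\max\{\min\{|w|: w\in L(E)\setminus L(E')\}: E,E' \text{ of size}\le c,\ L(E)\setminus L(E')\ne\emptyset\}$, where $L(E)$ is the language accepted by $E$; admitting non-asymptotic length generalization means that $f$ has a computable upper bound. *)

theory Defs
  imports Complex_Main
begin

datatype recf = RZ | RS | RId nat | RCn recf "recf list" | RPr recf recf | RMn recf

inductive rec_eval :: "recf \<Rightarrow> nat list \<Rightarrow> nat \<Rightarrow> bool" where
  zero: "rec_eval RZ xs 0"
| succ: "rec_eval RS (x # xs) (Suc x)"
| proj: "i < length xs \<Longrightarrow> rec_eval (RId i) xs (xs ! i)"
| comp: "list_all2 (\<lambda>g y. rec_eval g xs y) gs ys \<Longrightarrow> rec_eval f ys z \<Longrightarrow>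
         rec_eval (RCn f gs) xs z"
| pr0:  "rec_eval f xs y \<Longrightarrow> rec_eval (RPr f g) (0 # xs) y"
| prS:  "rec_eval (RPr f g) (n # xs) y \<Longrightarrow> rec_eval g (n # y # xs) z \<Longrightarrow>
         rec_eval (RPr f g) (Suc n # xs) z"
| mn:   "rec_eval f (n # xs) 0 \<Longrightarrow> (\<forall>m<n. \<exists>y. y > 0 \<and> rec_eval f (m # xs) y) \<Longrightarrow>
         rec_eval (RMn f) xs n"

definition computable :: "(nat \<Rightarrow> nat) \<Rightarrow> bool" where
  "computable g \<longleftrightarrow> (\<exists>r. \<forall>n. rec_eval r [n] (g n))"

definition FF :: "nat \<Rightarrow> int \<Rightarrow> real set" where
  "FF p s = {of_int m * 2 powr (- of_int s) | m. - (2 ^ (p - 1)) \<le> m \<and> m < 2 ^ (p - 1)}"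

definition rnd :: "nat \<Rightarrow> int \<Rightarrow> real \<Rightarrow> real" where
  "rnd p s x = (if \<exists>y\<in>FF p s. y \<le> x then Max {y\<in>FF p s. y \<le> x} else Min (FF p s))"

definition FV :: "nat \<Rightarrow> int \<Rightarrow> nat \<Rightarrow> real list set" where
  "FV p s d = {v. length v = d \<and> set v \<subseteq> FF p s}"

definition dot :: "real list \<Rightarrow> real list \<Rightarrow> real" where
  "dot u v = (\<Sum>t<length u. u ! t * v ! t)"

record layer =
  WQ :: "real list \<Rightarrow> real list"
  WK :: "real list \<Rightarrow> real list"
  WV :: "real list \<Rightarrow> real list"
  FN :: "real list \<Rightarrow> real list"

record transformer =
  tp :: nat
  ts :: int
  td :: nat
  emb :: "nat \<Rightarrow> real list"
  layers :: "layer list"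
  wout :: "real list \<Rightarrow> real"

definition depth :: "transformer \<Rightarrow> nat" where
  "depth T = length (layers T)"

definition wf_transformer :: "nat \<Rightarrow> transformer \<Rightarrow> bool" where
  "wf_transformer n T \<longleftrightarrow> tp T \<ge> 1 \<and>
     (\<forall>a<n. emb T a \<in> FV (tp T) (ts T) (td T)) \<and>
     (\<forall>L\<in>set (layers T). \<forall>v\<in>FV (tp T) (ts T) (td T).
        WQ L v \<in> FV (tp T) (ts T) (td T) \<and> WK L v \<in> FV (tp T) (ts T) (td T) \<and>
        WV L v \<in> FV (tp T) (ts T) (td T) \<and> FN L v \<in> FV (tp T) (ts T) (td T)) \<and>
     (\<forall>v\<in>FV (tp T) (ts T) (td T). wout T v \<in> FF (tp T) (ts T))"

definition apply_layer :: "nat \<Rightarrow> int \<Rightarrow> nat \<Rightarrow> layer \<Rightarrow> real list list \<Rightarrow> real list list" where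
  "apply_layer p s d L hs =
     map (\<lambda>i.
       let wt = (\<lambda>j. rnd p s (exp (dot (WQ L (hs ! i)) (WK L (hs ! j)))));
           B = (\<Sum>j\<le>i. wt j);
           c = (if B = 0
                then map (\<lambda>t. rnd p s ((\<Sum>j\<le>i. WV L (hs ! j) ! t) / real (Suc i))) [0..<d]
                else map (\<lambda>t. rnd p s ((\<Sum>j\<le>i. wt j * WV L (hs ! j) ! t) / B)) [0..<d])
       in FN L (map (\<lambda>t. rnd p s (c ! t + hs ! i ! t)) [0..<d]))
     [0..<length hs]"

definition run :: "transformer \<Rightarrow> nat list \<Rightarrow> real list list" where
  "run T w = foldl (\<lambda>hs L. apply_layer (tp T) (ts T) (td T) L hs) (map (emb T) w) (layers T)"

definition accepts :: "transformer \<Rightarrow> nat list \<Rightarrow> bool" where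
  "accepts T w \<longleftrightarrow> w \<noteq> [] \<and> wout T (last (run T w)) > 0"

definition lang :: "nat \<Rightarrow> transformer \<Rightarrow> nat list set" where
  "lang n T = {w. set w \<subseteq> {..<n} \<and> accepts T w}"

fun nat_bits :: "nat \<Rightarrow> nat" where
  "nat_bits k = (if k = 0 then 0 else Suc (nat_bits (k div 2)))"

text \<open>Binary size of a constant x = m * 2^(-s): sign bit plus binary length of |m|.\<close>
definition cbits :: "int \<Rightarrow> real \<Rightarrow> nat" where
  "cbits s x = Suc (nat_bits (nat \<bar>\<lfloor>x * 2 powr of_int s\<rfloor>\<bar>))"

definition table_size :: "nat \<Rightarrow> int \<Rightarrow> nat \<Rightarrow> (real list \<Rightarrow> real list) \<Rightarrow> nat" where
  "table_size p s d W = (\<Sum>v\<in>FV p s d. \<Sum>t<d. cbits s (W v ! t))"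

definition tsize :: "nat \<Rightarrow> transformer \<Rightarrow> nat" where
  "tsize n T = tp T + nat \<bar>ts T\<bar> + td T + depth T
     + (\<Sum>a<n. \<Sum>t<td T. cbits (ts T) (emb T a ! t))
     + sum_list (map (\<lambda>L. table_size (tp T) (ts T) (td T) (WQ L)
                       + table_size (tp T) (ts T) (td T) (WK L)
                       + table_size (tp T) (ts T) (td T) (WV L)
                       + table_size (tp T) (ts T) (td T) (FN L)) (layers T))
     + (\<Sum>v\<in>FV (tp T) (ts T) (td T). cbits (ts T) (wout T v))"

definition length_complexity :: "nat \<Rightarrow> nat set \<Rightarrow> nat \<Rightarrow> nat" where
  "length_complexity n D c = Sup
     {LEAST l. \<exists>w\<in>lang n T - lang n T'. length w = l | T T'.
        wf_transformer n T \<and> wf_transformer n T' \<and> depth T \<in> D \<and> depth T' \<in> D \<and>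
        tsize n T \<le> c \<and> tsize n T' \<le> c \<and> lang n T - lang n T' \<noteq> {}}"

definition admits_nonasymptotic_length_generalization :: "nat \<Rightarrow> nat set \<Rightarrow> bool" where
  "admits_nonasymptotic_length_generalization n D \<longleftrightarrow>
     (\<exists>g. computable g \<and> (\<forall>c. length_complexity n D c \<le> g c))"

end

theory Submission
  imports Defs "HOL-Computational_Algebra.Primes" "HOL-Library.FuncSet"
begin

text \<open>
  Uniform attention with values \<open>F(w_j)\<close> computes the average of an integer weight \<open>F\<close> over a prefix,
  and rounding down preserves its sign. One layer can therefore test linear inequalities between letter
  counts at every position, and a second layer can check that no position has failed its test.

  Such tests suffice to recognise the words that encode the runs of a two-counter machine over an
  alphabet independent of the machine, with the input of the machine entering as the weight of the start
  letter. Given a computable \<open>g\<close>, take a machine that on input \<open>x\<close> computes \<open>g (S x)\<close>, where \<open>S x\<close>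
  bounds the size of the corresponding transformer as soon as \<open>x\<close> exceeds the parameters of the machine.
  The only runs end with a counter exceeding its initial value by at least \<open>g (S x)\<close>, and a letter changes
  a counter by at most one, so that transformer accepts some word but none of length up to \<open>g (S x)\<close>.
\<close>

section \<open>Compiling recursive functions to register programs\<close>

text \<open>The alphabet size is fixed while \<open>c\<close> varies, so a machine can only be
  placed into the dimension and the table entries. The input must not be built into the machine,
  whose number of states would then grow with it; as a constant it costs only its bits. Registers
  are packed into one counter by prime powers, so input \<open>x\<close> becomes
  \<open>pr 0 ^ x\<close>, at most \<open>2 ^ (x * x)\<close> once \<open>x\<close> reaches
  \<open>pr 0\<close>; hence the precision \<open>x + x * x\<close>. There is an apparent circle:
  the program computes \<open>g (S x)\<close>, while \<open>S x\<close> bounds the transformer built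
  from that program. \<open>S\<close> avoids it by mentioning only \<open>x\<close>, which stands in
  for the dimension; the program is fixed before \<open>x\<close> is chosen. The initial counter
  value comes for free with one letter, so only growth beyond it forces length. Output
  \<open>y\<close> multiplies the counter by \<open>pr 1 ^ y\<close>, which adds at least
  \<open>y\<close>. Programs guess, and wrong guesses must block. Semantics are therefore relations,
  and the statements fix the exact image of a state: existence of an outcome makes the language
  nonempty, its uniqueness bounds every accepted word from below.\<close>

datatype 'o prog = Op 'o | Seq "'o prog" "'o prog" | Alt "'o prog" "'o prog" | Star "'o prog"

lemma finite_set_prog: "finite (set_prog P)"
  by (induction P) auto

primrec sem :: "('o \<Rightarrow> 's rel) \<Rightarrow> 'o prog \<Rightarrow> 's rel" where
  "sem I (Op a) = I a"
| "sem I (Seq P Q) = sem I P O sem I Q"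
| "sem I (Alt P Q) = sem I P \<union> sem I Q"
| "sem I (Star P) = (sem I P)\<^sup>*"

lemma sem_Seq_Image: "sem I (Seq P Q) `` A = sem I Q `` (sem I P `` A)"
  by auto

lemma sem_Seq_singleton:
  "sem I P `` {s} = {t} \<Longrightarrow> sem I Q `` {t} = A \<Longrightarrow> sem I (Seq P Q) `` {s} = A"
  by (simp only: sem_Seq_Image)

text \<open>\<open>Star\<close> guesses the number of rounds. Leaving early is blocked by
  \<open>stay\<close>, a further round by \<open>stuck\<close>, so only the guess \<open>k\<close>
  survives and the nondeterministic loop acts as a while loop.\<close>

lemma sem_while_Image:
  assumes body: "\<And>i. i < k \<Longrightarrow> sem I B `` {s i} = {s (Suc i)}"
    and stay: "\<And>i. i < k \<Longrightarrow> sem I E `` {s i} = {}"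
    and stuck: "sem I B `` {s k} = {}"
    and leave: "sem I E `` {s k} = {t}"
  shows "sem I (Seq (Star B) E) `` {s 0} = {t}"
proof -
  have fwd: "(s 0, s i) \<in> (sem I B)\<^sup>*" if "i \<le> k" for i
    using that
  proof (induction i)
    case (Suc i)
    then have "(s i, s (Suc i)) \<in> sem I B" using body[of i] by auto
    with Suc show ?case by (auto intro: rtrancl_into_rtrancl)
  qed simp
  have bwd: "\<exists>i\<le>k. u = s i" if "(s 0, u) \<in> (sem I B)\<^sup>*" for u
    using that
  proof (induction rule: rtrancl_induct)
    case (step u v)
    then obtain i where i: "i \<le> k" "u = s i" by blast
    show ?case
    proof (cases "i = k")
      case True
      with step i stuck show ?thesis by auto
    next
      case False
      with i have "v = s (Suc i)" using body[of i] step by auto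
      with False i show ?thesis by (intro exI[of _ "Suc i"]) auto
    qed
  qed auto
  show ?thesis
  proof (intro equalityI subsetI)
    fix v assume "v \<in> sem I (Seq (Star B) E) `` {s 0}"
    then obtain u where u: "(s 0, u) \<in> (sem I B)\<^sup>*" "(u, v) \<in> sem I E" by auto
    then obtain i where i: "i \<le> k" "u = s i" using bwd by blast
    with u stay[of i] have "i = k" by (cases "i = k") auto
    with i u leave show "v \<in> {t}" by auto
  next
    fix v assume "v \<in> {t}"
    with leave have "(s k, v) \<in> sem I E" by auto
    with fwd[of k] show "v \<in> sem I (Seq (Star B) E) `` {s 0}" by auto
  qed
qed

section \<open>Register operations and loops\<close>

datatype rop = Inc nat | Dec nat | Zero nat

fun rop_reg :: "rop \<Rightarrow> nat" where
  "rop_reg (Inc r) = r" | "rop_reg (Dec r) = r" | "rop_reg (Zero r) = r"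

fun rop_sem :: "rop \<Rightarrow> (nat \<Rightarrow> nat) rel" where
  "rop_sem (Inc r) = {(s, s(r := Suc (s r))) | s. True}"
| "rop_sem (Dec r) = {(s, s(r := s r - 1)) | s. s r > 0}"
| "rop_sem (Zero r) = {(s, s) | s. s r = 0}"

lemma rop_sem_Image:
  "rop_sem (Inc r) `` {s} = {s(r := Suc (s r))}"
  "s r > 0 \<Longrightarrow> rop_sem (Dec r) `` {s} = {s(r := s r - 1)}"
  "s r = 0 \<Longrightarrow> rop_sem (Dec r) `` {s} = {}"
  "s r = 0 \<Longrightarrow> rop_sem (Zero r) `` {s} = {s}"
  "s r > 0 \<Longrightarrow> rop_sem (Zero r) `` {s} = {}"
  by auto

abbreviation "rsem \<equiv> sem rop_sem"

abbreviation while_nz :: "nat \<Rightarrow> rop prog \<Rightarrow> rop prog" where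
  "while_nz r B \<equiv> Seq (Star (Seq (Op (Dec r)) B)) (Op (Zero r))"

lemma rsem_while_nz:
  assumes body: "\<And>i. i < k \<Longrightarrow> s i r > 0 \<and> rsem B `` {(s i)(r := s i r - 1)} = {s (Suc i)}"
    and leave: "s k r = 0" and start: "s 0 = s0" and "s k = t"
  shows "rsem (while_nz r B) `` {s0} = {t}"
proof -
  have "rsem (while_nz r B) `` {s 0} = {s k}"
  proof (rule sem_while_Image)
    show "rsem (Seq (Op (Dec r)) B) `` {s i} = {s (Suc i)}" if "i < k" for i
      using body[OF that] by (simp only: relcomp_Image sem.simps rop_sem_Image)
    show "rsem (Op (Zero r)) `` {s i} = {}" if "i < k" for i
      using body[OF that] by (simp only: sem.simps rop_sem_Image)
    show "rsem (Seq (Op (Dec r)) B) `` {s k} = {}"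
      using leave by (simp only: relcomp_Image sem.simps rop_sem_Image Image_empty2)
    show "rsem (Op (Zero r)) `` {s k} = {s k}"
      using leave by (simp only: sem.simps rop_sem_Image)
  qed
  then show ?thesis using assms by simp
qed

definition clear :: "nat \<Rightarrow> rop prog" where
  "clear r = Seq (Star (Op (Dec r))) (Op (Zero r))"

lemma rsem_clear: "rsem (clear r) `` {s} = {s(r := 0)}"
proof -
  have "rsem (clear r) `` {(\<lambda>i. s(r := s r - i)) 0} = {s(r := 0)}"
    unfolding clear_def
    by (rule sem_while_Image[where k = "s r"])
       (auto simp del: rop_sem.simps simp: rop_sem_Image)
  then show ?thesis by simp
qed

text \<open>A register is read by counting it down, so its content goes to \<open>z\<close> and
  \<open>t\<close> together and is restored from \<open>t\<close>.\<close>

definition copy :: "nat \<Rightarrow> nat \<Rightarrow> nat \<Rightarrow> rop prog" where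
  "copy r z t = Seq (while_nz r (Seq (Op (Inc z)) (Op (Inc t)))) (while_nz t (Op (Inc r)))"

lemma rsem_copy:
  assumes "r \<noteq> z" "r \<noteq> t" "z \<noteq> t" "s t = 0" "s z = 0"
  shows "rsem (copy r z t) `` {s} = {s(z := s r)}"
proof -
  have "rsem (while_nz r (Seq (Op (Inc z)) (Op (Inc t)))) `` {s} = {s(r := 0, z := s r, t := s r)}"
    by (rule rsem_while_nz[where k = "s r" and s = "\<lambda>i. s(r := s r - i, z := i, t := i)"])
       (use assms in \<open>auto simp: relcomp_Image fun_eq_iff rop_sem_Image simp del: rop_sem.simps\<close>)
  moreover have "rsem (while_nz t (Op (Inc r))) `` {s(r := 0, z := s r, t := s r)} = {s(z := s r)}"
    by (rule rsem_while_nz[where k = "s r" and s = "\<lambda>i. s(r := i, z := s r, t := s r - i)"])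
       (use assms in \<open>auto simp: relcomp_Image fun_eq_iff rop_sem_Image simp del: rop_sem.simps\<close>)
  ultimately show ?thesis unfolding copy_def sem_Seq_Image by simp
qed

fun seqs :: "rop prog list \<Rightarrow> rop prog \<Rightarrow> rop prog" where
  "seqs [] Q = Q"
| "seqs (P # Ps) Q = Seq P (seqs Ps Q)"

text \<open>\<open>compile f xs z b\<close> puts the value of \<open>f\<close> at the contents of the registers \<open>xs\<close> into \<open>z\<close>;
  all registers from \<open>b\<close> on are scratch space and are zero before and after.\<close>

function compile :: "recf \<Rightarrow> nat list \<Rightarrow> nat \<Rightarrow> nat \<Rightarrow> rop prog" where
  "compile RZ xs z b = Op (Zero z)"
| "compile RS xs z b = Seq (copy (hd xs) z b) (Op (Inc z))"
| "compile (RId i) xs z b = copy (xs ! i) z b"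
| "compile (RCn f gs) xs z b = (let k = length gs in
     seqs (map (\<lambda>(i, g). compile g xs (b + i) (b + k)) (zip [0..<k] gs))
       (Seq (compile f [b..<b + k] z (b + k))
          (seqs (map clear [b..<b + k]) (Op (Zero b)))))"
| "compile (RPr f g) xs z b =
     seqs [compile f (tl xs) (b + 1) (b + 4), copy (hd xs) (b + 3) (b + 4),
       while_nz (b + 3)
         (seqs [compile g (b # (b + 1) # tl xs) (b + 2) (b + 4), clear (b + 1),
            copy (b + 2) (b + 1) (b + 4), clear (b + 2)] (Op (Inc b))),
       copy (b + 1) z (b + 4), clear b] (clear (b + 1))"
| "compile (RMn f) xs z b =
     seqs [compile f (b # xs) (b + 1) (b + 2),
       while_nz (b + 1)
         (seqs [clear (b + 1), Op (Inc b)] (compile f (b # xs) (b + 1) (b + 2))),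
       copy b z (b + 2)] (clear b)"

  by pat_completeness auto
termination
proof (relation "measure (\<lambda>(f, _). size f)")
  fix f and gs :: "recf list" and xs :: "nat list" and z b k :: nat and p i g
  assume "p \<in> set (zip [0..<k] gs)" "(i, g) = p"
  then have "g \<in> set gs" by (auto dest: set_zip_rightD)
  then show "((g, xs, b + i, b + k), RCn f gs, xs, z, b) \<in> measure (\<lambda>(f, _). size f)"
    by (auto dest!: size_list_estimation'[where f = size, OF _ order_refl])
qed auto

inductive_cases rec_eval_RZ: "rec_eval RZ xs y"
inductive_cases rec_eval_RS: "rec_eval RS xs y"
inductive_cases rec_eval_RId: "rec_eval (RId i) xs y"
inductive_cases rec_eval_RCn: "rec_eval (RCn f gs) xs y"
inductive_cases rec_eval_RPr: "rec_eval (RPr f g) xs y"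
inductive_cases rec_eval_RMn: "rec_eval (RMn f) xs y"

text \<open>Unwinding the recursion into a sequence \<open>a\<close> lets the state after each round
  of the compiled loop be written down explicitly.\<close>

lemma rec_eval_RPr_trace:
  "rec_eval (RPr f g) (n # xs) y \<Longrightarrow>
   \<exists>a. rec_eval f xs (a 0) \<and> (\<forall>i<n. rec_eval g (i # a i # xs) (a (Suc i))) \<and> a n = y"
proof (induction n arbitrary: y)
  case 0
  then have "rec_eval f xs y" by (auto elim: rec_eval_RPr)
  then show ?case by (intro exI[of _ "\<lambda>_. y"]) auto
next
  case (Suc n)
  then obtain v where v: "rec_eval (RPr f g) (n # xs) v" "rec_eval g (n # v # xs) y"
    by (auto elim: rec_eval_RPr)
  with Suc.IH obtain a where "rec_eval f xs (a 0)" "\<forall>i<n. rec_eval g (i # a i # xs) (a (Suc i))"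
    "a n = v" by blast
  with v show ?case by (intro exI[of _ "a(Suc n := y)"]) (auto simp: less_Suc_eq)
qed

text \<open>Nothing is asked where \<open>f\<close> has no value: a derivation of a value supplies
  values for all subcalls that the program makes.\<close>

definition computes :: "rop prog \<Rightarrow> recf \<Rightarrow> nat list \<Rightarrow> nat \<Rightarrow> nat \<Rightarrow> bool" where
  "computes P f xs z b \<longleftrightarrow> (\<forall>s y. rec_eval f (map s xs) y \<longrightarrow> (\<forall>r\<ge>b. s r = 0) \<longrightarrow> s z = 0 \<longrightarrow>
     rsem P `` {s} = {s(z := y)})"

lemma computesD:
  "computes P f xs z b \<Longrightarrow> rec_eval f (map s xs) y \<Longrightarrow> (\<And>r. r \<ge> b \<Longrightarrow> s r = 0) \<Longrightarrow> s z = 0 \<Longrightarrow>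
   rsem P `` {s} = {s(z := y)}"
  unfolding computes_def by blast

lemma rsem_clears:
  "rsem (seqs (map clear rs) Q) `` {s} = rsem Q `` {\<lambda>r. if r \<in> set rs then 0 else s r}"
proof (induction rs arbitrary: s)
  case (Cons r rs)
  have "rsem (seqs (map clear (r # rs)) Q) `` {s} = rsem (seqs (map clear rs) Q) `` {s(r := 0)}"
    by (simp only: list.map seqs.simps sem_Seq_Image rsem_clear)
  also have "\<dots> = rsem Q `` {\<lambda>r'. if r' \<in> set (r # rs) then 0 else s r'}"
    unfolding Cons.IH by (rule arg_cong[where f = "\<lambda>x. rsem Q `` {x}"]) auto
  finally show ?case .
qed simp

text \<open>The offset \<open>j\<close> serves the induction: only slots from \<open>b + j\<close>
  on must still be zero, while those below already hold results. The scratch boundary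
  \<open>e\<close> stays fixed.\<close>

lemma rsem_compile_args:
  assumes gs: "\<And>g z. g \<in> set gs \<Longrightarrow> z < e \<Longrightarrow> z \<notin> set xs \<Longrightarrow> computes (C g z) g xs z e"
    and "list_all2 (\<lambda>g y. rec_eval g (map s xs) y) gs ys" "\<And>r. r \<ge> b + j \<Longrightarrow> s r = 0"
    and "set xs \<subseteq> {..<b}" "b + j + length gs = e"
  shows "rsem (seqs (map (\<lambda>(i, g). C g (b + i)) (zip [j..<j + length gs] gs)) Q) `` {s} =
    rsem Q `` {\<lambda>r. if b + j \<le> r \<and> r < b + j + length gs then ys ! (r - (b + j)) else s r}"
  using assms
proof (induction gs arbitrary: ys j s)
  case Nil
  have "(\<lambda>r. if b + j \<le> r \<and> r < b + j + length [] then ys ! (r - (b + j)) else s r) = s"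
    by auto
  then show ?case by simp
next
  case (Cons g gs)
  then obtain y ys' where ys: "ys = y # ys'" "rec_eval g (map s xs) y"
    "list_all2 (\<lambda>g y. rec_eval g (map s xs) y) gs ys'"
    by (auto simp: list_all2_Cons1)
  have notin: "b + j \<notin> set xs" using Cons.prems(4) by auto
  have "computes (C g (b + j)) g xs (b + j) e"
    using Cons.prems(1)[of g "b + j"] notin Cons.prems(5) by auto
  then have 1: "rsem (C g (b + j)) `` {s} = {s(b + j := y)}"
    by (rule computesD) (use ys Cons.prems in auto)
  have same: "map (s(b + j := y)) xs = map s xs" using notin by auto
  have args: "list_all2 (\<lambda>g y'. rec_eval g (map (s(b + j := y)) xs) y') gs ys'"
    unfolding same by (rule ys(3))
  have upt: "[j..<j + length (g # gs)] = j # [Suc j..<Suc j + length gs]"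
    by (simp add: upt_rec)
  have 2: "rsem (seqs (map (\<lambda>(i, g). C g (b + i)) (zip [Suc j..<Suc j + length gs] gs)) Q) ``
      {s(b + j := y)} =
    rsem Q `` {\<lambda>r. if b + Suc j \<le> r \<and> r < b + Suc j + length gs then ys' ! (r - (b + Suc j))
       else (s(b + j := y)) r}"
    by (rule Cons.IH[OF _ args]) (use Cons.prems in auto)
  have "rsem (seqs (map (\<lambda>(i, g). C g (b + i)) (zip [j..<j + length (g # gs)] (g # gs))) Q) `` {s}
    = rsem (seqs (map (\<lambda>(i, g). C g (b + i)) (zip [Suc j..<Suc j + length gs] gs)) Q) ``
      {s(b + j := y)}"
    unfolding upt by (simp only: zip_Cons_Cons list.map prod.case seqs.simps sem_Seq_Image 1)
  also have "\<dots> = rsem Q `` {\<lambda>r. if b + j \<le> r \<and> r < b + j + length (g # gs)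
      then ys ! (r - (b + j)) else s r}"
    unfolding 2 by (rule arg_cong[where f = "\<lambda>x. rsem Q `` {x}"])
      (auto simp: fun_eq_iff ys(1) nth_Cons' Suc_diff_Suc diff_diff_add)
  finally show ?case .
qed

lemma computes_compile:
  "set xs \<subseteq> {..<b} \<Longrightarrow> z < b \<Longrightarrow> z \<notin> set xs \<Longrightarrow> computes (compile f xs z b) f xs z b"
proof (induction f arbitrary: xs z b)
  case RZ
  then show ?case by (auto simp: computes_def fun_upd_idem elim!: rec_eval_RZ)
next
  case RS
  have "rsem (compile RS xs z b) `` {s} = {s(z := y)}"
    if ev: "rec_eval RS (map s xs) y" and "\<forall>r\<ge>b. s r = 0" and "s z = 0" for s y
  proof -
    obtain x xs' where xs: "xs = x # xs'" "y = Suc (s x)"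
      using ev by (cases xs) (auto elim!: rec_eval_RS)
    have "rsem (copy x z b) `` {s} = {s(z := s x)}"
      by (rule rsem_copy) (use xs RS that in auto)
    then show ?thesis
      unfolding compile.simps xs(1) list.sel sem_Seq_Image
      by (simp only: sem.simps rop_sem_Image xs(2)) simp
  qed
  then show ?case by (auto simp only: computes_def)
next
  case (RId i)
  have "rsem (compile (RId i) xs z b) `` {s} = {s(z := y)}"
    if "rec_eval (RId i) (map s xs) y" "\<forall>r\<ge>b. s r = 0" "s z = 0" for s y
  proof -
    have i: "i < length xs" "y = s (xs ! i)"
      using that(1) by (auto elim!: rec_eval_RId)
    then have "xs ! i \<in> set xs" by simp
    then have "rsem (copy (xs ! i) z b) `` {s} = {s(z := s (xs ! i))}"
      by (intro rsem_copy) (use RId that in auto)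
    then show ?thesis using i by simp
  qed
  then show ?case by (auto simp only: computes_def)
next
  case (RCn f gs)
  define k where "k = length gs"
  have "rsem (compile (RCn f gs) xs z b) `` {s} = {s(z := y)}"
    if ev: "rec_eval (RCn f gs) (map s xs) y" and s0: "\<forall>r\<ge>b. s r = 0" and sz: "s z = 0" for s y
  proof -
    obtain ys where ys: "list_all2 (\<lambda>g y. rec_eval g (map s xs) y) gs ys" "rec_eval f ys y"
      using ev by (auto elim!: rec_eval_RCn)
    have len: "length ys = k" using ys(1) by (simp add: k_def list_all2_lengthD)
    define s1 where "s1 = (\<lambda>r. if b \<le> r \<and> r < b + k then ys ! (r - b) else s r)"
    have args: "rsem (seqs (map (\<lambda>(i, g). compile g xs (b + i) (b + k)) (zip [0..<k] gs)) Q) `` {s}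
      = rsem Q `` {s1}" for Q
    proof -
      have "rsem (seqs (map (\<lambda>(i, g). compile g xs (b + i) (b + k)) (zip [0..<0 + length gs] gs)) Q)
        `` {s} = rsem Q `` {\<lambda>r. if b + 0 \<le> r \<and> r < b + 0 + length gs then ys ! (r - (b + 0))
          else s r}"
        by (rule rsem_compile_args[where C = "\<lambda>g z. compile g xs z (b + k)" and e = "b + k"])
           (use RCn ys s0 in \<open>auto simp: k_def intro!: RCn.IH\<close>)
      then show ?thesis by (simp only: s1_def k_def add_0 add_0_right)
    qed
    have "map s1 [b..<b + k] = ys"
      by (rule nth_equalityI) (auto simp: s1_def len)
    then have "rsem (compile f [b..<b + k] z (b + k)) `` {s1} = {s1(z := y)}"
      by (intro computesD[OF RCn.IH(1)]) (use RCn.prems ys s0 sz in \<open>auto simp: s1_def\<close>)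
    moreover have "(\<lambda>r. if r \<in> set [b..<b + k] then 0 else (s1(z := y)) r) = s(z := y)"
      using s0 RCn.prems by (auto simp: s1_def fun_eq_iff)
    \<comment> \<open>\<open>Zero b\<close> merely ends the list: \<open>b\<close> has been cleared,
      or is untouched scratch if there are no arguments.\<close>
    moreover have "rsem (Op (Zero b)) `` {s(z := y)} = {s(z := y)}"
      using s0 RCn.prems by auto
    ultimately show ?thesis
      unfolding compile.simps Let_def k_def[symmetric] args sem_Seq_Image
      by (simp only: sem_Seq_Image rsem_clears)
  qed
  then show ?case by (auto simp only: computes_def)
next
  case (RPr f g)
  have "rsem (compile (RPr f g) xs z b) `` {s} = {s(z := y)}"
    if ev: "rec_eval (RPr f g) (map s xs) y" and s0: "\<forall>r\<ge>b. s r = 0" and sz: "s z = 0" for s y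
  proof -
    obtain x xs' where xs: "xs = x # xs'"
      using ev by (cases xs) (auto elim!: rec_eval_RPr)
    then obtain a where a: "rec_eval f (map s xs') (a 0)"
      "\<And>i. i < s x \<Longrightarrow> rec_eval g (i # a i # map s xs') (a (Suc i))" "a (s x) = y"
      using rec_eval_RPr_trace[of f g "s x" "map s xs'" y] ev by auto
    have lt: "x < b" "set xs' \<subseteq> {..<b}" "z < b" "z \<noteq> x" "z \<notin> set xs'"
      using RPr.prems xs by auto
    then have ne: "r \<in> set xs' \<Longrightarrow> r < b" for r by auto
    have 1: "rsem (compile f xs' (b + 1) (b + 4)) `` {s} = {s(b + 1 := a 0)}"
      by (rule computesD[OF RPr.IH(1)]) (use lt s0 a in \<open>auto dest: ne\<close>)
    have 2: "rsem (copy x (b + 3) (b + 4)) `` {s(b + 1 := a 0)} = {s(b + 1 := a 0, b + 3 := s x)}"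
      by (subst rsem_copy) (use lt s0 in auto)
    \<comment> \<open>Loop state: \<open>b\<close> is the round, \<open>b + 1\<close> the value so
      far, \<open>b + 3\<close> the rounds left; \<open>b + 2\<close> takes the next value and is
      zero between rounds.\<close>
    define st where "st = (\<lambda>i. s(b + 1 := a i, b + 3 := s x - i, b := i))"
    let ?B = "seqs [compile g (b # (b + 1) # xs') (b + 2) (b + 4), clear (b + 1),
            copy (b + 2) (b + 1) (b + 4), clear (b + 2)] (Op (Inc b))"
    have 3: "rsem (while_nz (b + 3) ?B) `` {s(b + 1 := a 0, b + 3 := s x)} = {st (s x)}"
    proof (rule rsem_while_nz[where k = "s x" and s = st])
      fix i assume i: "i < s x"
      let ?t = "s(b + 1 := a i, b + 3 := s x - Suc i, b := i)"
      have m: "map ?t (b # (b + 1) # xs') = i # a i # map s xs'"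
        by (auto dest: ne)
      have ev': "rec_eval g (map ?t (b # (b + 1) # xs')) (a (Suc i))"
        unfolding m by (rule a(2)[OF i])
      have b1: "rsem (compile g (b # (b + 1) # xs') (b + 2) (b + 4)) `` {?t} =
          {?t(b + 2 := a (Suc i))}"
        by (rule computesD[OF RPr.IH(2) ev']) (use lt s0 in \<open>auto dest: ne\<close>)
      have b2: "rsem (copy (b + 2) (b + 1) (b + 4)) `` {?t(b + 2 := a (Suc i), b + 1 := 0)} =
          {?t(b + 2 := a (Suc i), b + 1 := a (Suc i))}"
        by (subst rsem_copy) (use lt s0 in auto)
      have eq: "(st i)(b + 3 := st i (b + 3) - 1) = ?t"
        by (auto simp: st_def fun_eq_iff)
      have "rsem ?B `` {?t} = {st (Suc i)}"
        unfolding seqs.simps sem_Seq_Image b1 rsem_clear b2 sem.simps(1) rop_sem_Image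
        by (auto simp: st_def fun_eq_iff s0)
      with i show "st i (b + 3) > 0 \<and> rsem ?B `` {(st i)(b + 3 := st i (b + 3) - 1)} = {st (Suc i)}"
        unfolding eq by (simp add: st_def)
    qed (use s0 in \<open>auto simp: st_def fun_eq_iff\<close>)
    have 4: "rsem (copy (b + 1) z (b + 4)) `` {st (s x)} = {(st (s x))(z := y)}"
      by (subst rsem_copy) (use lt s0 sz a in \<open>auto simp: st_def\<close>)
    have 5: "(st (s x))(z := y, b := 0, b + 1 := 0) = s(z := y)"
      using lt s0 by (auto simp: st_def fun_eq_iff)
    show ?thesis
      unfolding compile.simps xs list.sel seqs.simps
      by (intro sem_Seq_singleton[OF 1] sem_Seq_singleton[OF 2] sem_Seq_singleton[OF 4]
          sem_Seq_singleton[OF 3[unfolded seqs.simps]] sem_Seq_singleton[OF rsem_clear])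
         (simp only: rsem_clear 5)
  qed
  then show ?case by (auto simp only: computes_def)
next
  case (RMn f)
  have "rsem (compile (RMn f) xs z b) `` {s} = {s(z := y)}"
    if ev: "rec_eval (RMn f) (map s xs) y" and s0: "\<forall>r\<ge>b. s r = 0" and sz: "s z = 0" for s y
  proof -
    \<comment> \<open>With \<open>b\<close> holding the candidate and \<open>b + 1\<close> the value
      there, the loop goes on exactly as long as this value is nonzero, that is, until
      \<open>y\<close>.\<close>
    have "\<exists>v. \<forall>m\<le>y. rec_eval f (m # map s xs) (v m) \<and> (v m = 0 \<longleftrightarrow> m = y)"
    proof -
      have "\<forall>m. \<exists>v. m \<le> y \<longrightarrow> rec_eval f (m # map s xs) v \<and> (v = 0 \<longleftrightarrow> m = y)"
        using ev by (auto elim!: rec_eval_RMn simp: le_less)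
      then show ?thesis by metis
    qed
    then obtain v where v: "\<And>m. m \<le> y \<Longrightarrow> rec_eval f (m # map s xs) (v m)"
      "\<And>m. m < y \<Longrightarrow> v m > 0" "v y = 0"
      by (metis le_less less_irrefl neq0_conv)
    have lt: "set xs \<subseteq> {..<b}" "z < b" "z \<notin> set xs" using RMn.prems by auto
    then have ne: "r \<in> set xs \<Longrightarrow> r < b" for r by auto
    have step: "rsem (compile f (b # xs) (b + 1) (b + 2)) `` {s(b := m)} = {s(b := m, b + 1 := v m)}"
      if "m \<le> y" for m
    proof -
      have m: "map (s(b := m)) (b # xs) = m # map s xs" by (auto dest: ne)
      have ev': "rec_eval f (map (s(b := m)) (b # xs)) (v m)" unfolding m by (rule v(1)[OF that])
      show ?thesis
        by (rule computesD[OF RMn.IH ev']) (use lt s0 in \<open>auto dest: ne\<close>)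
    qed
    define st where "st = (\<lambda>m. s(b := m, b + 1 := v m))"
    have 1: "rsem (compile f (b # xs) (b + 1) (b + 2)) `` {s} = {st 0}"
    proof -
      have "s(b := 0) = s" using s0 by auto
      then show ?thesis using step[of 0] by (simp add: st_def)
    qed
    let ?B = "seqs [clear (b + 1), Op (Inc b)] (compile f (b # xs) (b + 1) (b + 2))"
    have 2: "rsem (while_nz (b + 1) ?B) `` {st 0} = {s(b := y)}"
    proof (rule rsem_while_nz[where k = y and s = st])
      fix i assume i: "i < y"
      have eq: "(st i)(b + 1 := st i (b + 1) - 1, b + 1 := 0) = s(b := i)"
        using s0 by (auto simp: st_def fun_eq_iff)
      have "rsem ?B `` {(st i)(b + 1 := st i (b + 1) - 1)} = {st (Suc i)}"
        unfolding seqs.simps sem_Seq_Image rsem_clear eq sem.simps(1) rop_sem_Image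
        using step[of "Suc i"] i by (simp add: st_def)
      with i v show "st i (b + 1) > 0 \<and> rsem ?B `` {(st i)(b + 1 := st i (b + 1) - 1)} = {st (Suc i)}"
        by (simp add: st_def)
    qed (use s0 v in \<open>auto simp: st_def fun_eq_iff\<close>)
    have 3: "rsem (copy b z (b + 2)) `` {s(b := y)} = {s(b := y, z := y)}"
      by (subst rsem_copy) (use lt s0 sz in auto)
    have 4: "s(b := y, z := y, b := 0) = s(z := y)"
      using lt s0 by (auto simp: fun_eq_iff)
    show ?thesis
      unfolding compile.simps seqs.simps
      by (intro sem_Seq_singleton[OF 1] sem_Seq_singleton[OF 3]
          sem_Seq_singleton[OF 2[unfolded seqs.simps]])
         (simp only: rsem_clear 4)
  qed
  then show ?case by (auto simp only: computes_def)
qed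

section \<open>From registers to two counters\<close>

primrec prog_bind :: "('a \<Rightarrow> 'b prog) \<Rightarrow> 'a prog \<Rightarrow> 'b prog" where
  "prog_bind t (Op a) = t a"
| "prog_bind t (Seq P Q) = Seq (prog_bind t P) (prog_bind t Q)"
| "prog_bind t (Alt P Q) = Alt (prog_bind t P) (prog_bind t Q)"
| "prog_bind t (Star P) = Star (prog_bind t P)"

text \<open>Translated operations lead from encodings only to encodings, so every state between two
  of them is again an encoding and the equation passes through \<open>Seq\<close> and
  \<open>Star\<close>.\<close>

lemma sem_prog_bind:
  assumes "\<And>a s. a \<in> set_prog P \<Longrightarrow> sem J (t a) `` {enc s} = enc ` (I a `` {s})"
  shows "sem J (prog_bind t P) `` {enc s} = enc ` (sem I P `` {s})"
  using assms
proof (induction P arbitrary: s)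
  case (Seq P Q)
  then have P: "sem J (prog_bind t P) `` {enc s} = enc ` (sem I P `` {s})" for s by simp
  have Q: "sem J (prog_bind t Q) `` {enc s} = enc ` (sem I Q `` {s})" for s using Seq by simp
  have "sem J (prog_bind t Q) `` (enc ` A) = enc ` (sem I Q `` A)" for A
    using Q by (subst (1 2) Image_eq_UN) (simp add: image_UN)
  then show ?case by (simp add: relcomp_Image P)
next
  case (Alt P Q)
  then show ?case by (simp add: Un_Image image_Un)
next
  case (Star P)
  then have P: "sem J (prog_bind t P) `` {enc s} = enc ` (sem I P `` {s})" for s by simp
  have 1: "\<exists>s'. u = enc s' \<and> (s, s') \<in> (sem I P)\<^sup>*"
    if "(enc s, u) \<in> (sem J (prog_bind t P))\<^sup>*" for u
    using that
  proof (induction rule: rtrancl_induct)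
    case (step u v)
    then obtain s' where s': "u = enc s'" "(s, s') \<in> (sem I P)\<^sup>*" by blast
    with step have "v \<in> enc ` (sem I P `` {s'})" unfolding P[symmetric] by auto
    with s' show ?case by (auto intro: rtrancl_into_rtrancl)
  qed blast
  have 2: "(enc s, enc s') \<in> (sem J (prog_bind t P))\<^sup>*" if "(s, s') \<in> (sem I P)\<^sup>*" for s'
    using that
  proof (induction rule: rtrancl_induct)
    case (step u v)
    then have "enc v \<in> sem J (prog_bind t P) `` {enc u}" unfolding P by auto
    with step show ?case by (auto intro: rtrancl_into_rtrancl)
  qed simp
  show ?case using 1 2 by auto
qed simp

datatype cop = IncA | DecA | ZeroA | IncB | DecB | ZeroB | Nop

fun cop_sem :: "cop \<Rightarrow> (nat \<times> nat) rel" where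
  "cop_sem IncA = {((a, b), (Suc a, b)) | a b. True}"
| "cop_sem DecA = {((Suc a, b), (a, b)) | a b. True}"
| "cop_sem ZeroA = {((0, b), (0, b)) | b. True}"
| "cop_sem IncB = {((a, b), (a, Suc b)) | a b. True}"
| "cop_sem DecB = {((a, Suc b), (a, b)) | a b. True}"
| "cop_sem ZeroB = {((a, 0), (a, 0)) | a. True}"
| "cop_sem Nop = Id"

abbreviation "csem \<equiv> sem cop_sem"

fun rep :: "nat \<Rightarrow> 'o prog \<Rightarrow> 'o prog \<Rightarrow> 'o prog" where
  "rep 0 P Q = Q"
| "rep (Suc k) P Q = Seq P (rep k P Q)"

lemma csem_rep:
  "csem (rep k (Op IncA) Q) `` {(a, b)} = csem Q `` {(a + k, b)}"
  "csem (rep k (Op IncB) Q) `` {(a, b)} = csem Q `` {(a, b + k)}"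
  "csem (rep k (Op DecA) Q) `` {(a, b)} = (if k \<le> a then csem Q `` {(a - k, b)} else {})"
proof -
  have A: "cop_sem IncA `` {(a, b)} = {(Suc a, b)}" and B: "cop_sem IncB `` {(a, b)} = {(a, Suc b)}"
    and D: "cop_sem DecA `` {(a, b)} = (if a = 0 then {} else {(a - 1, b)})" for a b
    by (auto simp: gr0_conv_Suc)
  show "csem (rep k (Op IncA) Q) `` {(a, b)} = csem Q `` {(a + k, b)}"
    by (induction k arbitrary: a) (simp_all add: relcomp_Image A del: cop_sem.simps)
  show "csem (rep k (Op IncB) Q) `` {(a, b)} = csem Q `` {(a, b + k)}"
    by (induction k arbitrary: b) (simp_all add: relcomp_Image B del: cop_sem.simps)
  show "csem (rep k (Op DecA) Q) `` {(a, b)} = (if k \<le> a then csem Q `` {(a - k, b)} else {})"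
    by (induction k arbitrary: a) (auto simp add: relcomp_Image D simp del: cop_sem.simps)
qed

abbreviation skip :: "cop prog" where "skip \<equiv> Op Nop"

text \<open>With a state \<open>s\<close> stored as the single number \<open>goedel pr R s\<close>, the register operations become
  multiplication, division and non-divisibility by a prime; the second counter is scratch space.\<close>

definition move_back :: "cop prog" where
  "move_back = Seq (Star (Seq (Op DecB) (Op IncA))) (Op ZeroB)"

lemma csem_move_back: "csem move_back `` {(0, b)} = {(b, 0)}"
proof -
  have D: "cop_sem DecB `` {(a, b)} = (if b = 0 then {} else {(a, b - 1)})"
    and A: "cop_sem IncA `` {(a, b)} = {(Suc a, b)}"
    and Z: "cop_sem ZeroB `` {(a, b)} = (if b = 0 then {(a, b)} else {})" for a b
    by (auto simp: gr0_conv_Suc)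
  have "csem move_back `` {(\<lambda>i. (i, b - i)) 0} = {(b, 0)}"
    unfolding move_back_def
    by (rule sem_while_Image[where k = b and s = "\<lambda>i. (i, b - i)"])
      (auto simp: relcomp_Image D A Z simp del: cop_sem.simps)
  then show ?thesis by simp
qed

lemma cop_sem_ZeroA_Image: "cop_sem ZeroA `` A = {(0, b) | b. (0, b) \<in> A}"
  by auto

lemma csem_transfer_star:
  assumes "m > 0"
  shows "(csem (rep m (Op DecA) (rep k (Op IncB) skip)))\<^sup>* `` {(a, 0)} =
    {(a - m * i, k * i) | i. m * i \<le> a}" (is "?R\<^sup>* `` _ = ?S")
proof -
  have step: "?R `` {(a, b)} = (if m \<le> a then {(a - m, b + k)} else {})" for a b
    by (simp add: csem_rep)
  have "(\<exists>i. u = (a - m * i, k * i) \<and> m * i \<le> a)" if "((a, 0), u) \<in> ?R\<^sup>*" for u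
    using that
  proof (induction rule: rtrancl_induct)
    case base
    show ?case by (rule exI[of _ 0]) simp
  next
    case (step u v)
    then obtain i where i: "u = (a - m * i, k * i)" "m * i \<le> a" by blast
    have "v \<in> ?R `` {u}" using step by blast
    then have "m \<le> a - m * i" "v = (a - m * i - m, k * i + k)"
      unfolding i \<open>\<And>b a. ?R `` {(a, b)} = _\<close> by (auto split: if_splits)
    with i show ?case by (intro exI[of _ "Suc i"]) (auto simp: algebra_simps)
  qed
  moreover have "((a, 0), (a - m * i, k * i)) \<in> ?R\<^sup>*" if "m * i \<le> a" for i
    using that
  proof (induction i)
    case (Suc i)
    have "(a - m * Suc i, k * Suc i) \<in> ?R `` {(a - m * i, k * i)}"
      unfolding step using Suc.prems by (auto simp: algebra_simps)
    with Suc show ?case by (auto intro: rtrancl_into_rtrancl)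
  qed simp
  ultimately show ?thesis by auto
qed

text \<open>Multiplies by \<open>k / m\<close>: \<open>m = 1\<close> is multiplication,
  \<open>k = 1\<close> is division. \<open>ZeroA\<close> succeeds only if portions of
  \<open>m\<close> exhaust the counter, so an indivisible content blocks.\<close>

definition scale :: "nat \<Rightarrow> nat \<Rightarrow> cop prog" where
  "scale m k = Seq (Seq (Star (rep m (Op DecA) (rep k (Op IncB) skip))) (Op ZeroA)) move_back"

lemma csem_scale:
  assumes "m > 0"
  shows "csem (scale m k) `` {(a, 0)} = (if m dvd a then {(k * (a div m), 0)} else {})"
proof -
  have "csem (Seq (Star (rep m (Op DecA) (rep k (Op IncB) skip))) (Op ZeroA)) `` {(a, 0)} =
    {(0, k * i) | i. m * i = a}"
    unfolding sem_Seq_Image sem.simps(1,4) csem_transfer_star[OF assms] cop_sem_ZeroA_Image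
    by (auto intro: le_antisym)
  also have "\<dots> = (if m dvd a then {(0, k * (a div m))} else {})"
    using assms by (auto simp: dvd_def)
  finally show ?thesis
    unfolding scale_def by (simp add: relcomp_Image csem_move_back)
qed

text \<open>Offers a choice of 1 to \<open>r + 1\<close> units to move, never none.\<close>

fun transfer_rem :: "nat \<Rightarrow> cop prog" where
  "transfer_rem 0 = Seq (Op DecA) (Op IncB)"
| "transfer_rem (Suc r) = Alt (transfer_rem r) (rep (r + 2) (Op DecA) (rep (r + 2) (Op IncB) skip))"

lemma csem_transfer_rem:
  "csem (transfer_rem r) `` {(a, b)} = {(a - j, b + j) | j. 1 \<le> j \<and> j \<le> Suc r \<and> j \<le> a}"
proof (induction r)
  case 0
  have "csem (transfer_rem 0) `` {(a, b)} = (if a > 0 then {(a - 1, b + 1)} else {})"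
    by (auto simp: gr0_conv_Suc)
  then show ?case by (auto simp: le_Suc_eq)
next
  case (Suc r)
  have "csem (transfer_rem (Suc r)) `` {(a, b)} = csem (transfer_rem r) `` {(a, b)} \<union>
      (if r + 2 \<le> a then {(a - (r + 2), b + (r + 2))} else {})"
    by (simp add: Un_Image csem_rep del: rep.simps)
  then show ?case unfolding Suc by (auto simp: le_Suc_eq)
qed

text \<open>With \<open>m - 2\<close> the final choice ranges over 1 to \<open>m - 1\<close>, the
  nonzero remainders. Units are moved one for one, so moving back restores the tested
  number.\<close>

definition nondvd :: "nat \<Rightarrow> cop prog" where
  "nondvd m = Seq (Seq (Star (rep m (Op DecA) (rep m (Op IncB) skip)))
     (Seq (transfer_rem (m - 2)) (Op ZeroA))) move_back"

lemma csem_nondvd: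
  assumes "m > 1"
  shows "csem (nondvd m) `` {(a, 0)} = (if m dvd a then {} else {(a, 0)})"
proof -
  have "csem (Seq (Star (rep m (Op DecA) (rep m (Op IncB) skip)))
     (Seq (transfer_rem (m - 2)) (Op ZeroA))) `` {(a, 0)} =
    {(0, m * i + j) | i j. m * i + j = a \<and> 1 \<le> j \<and> j < m}" (is "?L = ?M")
  proof -
    have lt: "j \<le> Suc (m - 2) \<longleftrightarrow> j < m" for j using assms by auto
    have "?L = cop_sem ZeroA `` (\<Union>i\<in>{i. m * i \<le> a}. csem (transfer_rem (m - 2)) `` {(a - m * i, m * i)})"
      using assms by (auto simp: relcomp_Image csem_transfer_star)
    also have "\<dots> = {(0, b) | b. \<exists>i j. m * i \<le> a \<and> 1 \<le> j \<and> j < m \<and> j \<le> a - m * i \<and>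
        0 = a - m * i - j \<and> b = m * i + j}"
      unfolding cop_sem_ZeroA_Image csem_transfer_rem lt by blast
    also have "\<dots> = ?M" by force
    finally show ?thesis .
  qed
  also have "\<dots> = (if m dvd a then {} else {(0, a)})"
  proof (cases "m dvd a")
    case True
    have False if "m * i + j = a" "1 \<le> j" "j < m" for i j
    proof -
      from that True have "m dvd j" by (metis dvd_add_right_iff dvd_triv_left)
      with that show False by (auto dest: dvd_imp_le)
    qed
    with True show ?thesis by auto
  next
    case False
    then have "m * (a div m) + a mod m = a" "1 \<le> a mod m" "a mod m < m"
      using assms by (auto simp: dvd_eq_mod_eq_0)
    then have "\<exists>i j. m * i + j = a \<and> 1 \<le> j \<and> j < m" by blast
    with False show ?thesis by auto
  qed
  finally show ?thesis
    unfolding nondvd_def by (simp add: relcomp_Image csem_move_back)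
qed

fun goedel_op :: "(nat \<Rightarrow> nat) \<Rightarrow> rop \<Rightarrow> cop prog" where
  "goedel_op pr (Inc r) = scale 1 (pr r)"
| "goedel_op pr (Dec r) = scale (pr r) 1"
| "goedel_op pr (Zero r) = nondvd (pr r)"

definition goedel :: "(nat \<Rightarrow> nat) \<Rightarrow> nat \<Rightarrow> (nat \<Rightarrow> nat) \<Rightarrow> nat" where
  "goedel pr R s = (\<Prod>i<R. pr i ^ s i)"

context
  fixes pr :: "nat \<Rightarrow> nat" and R :: nat
  assumes prime_pr: "\<And>i. prime (pr i)" and inj_pr: "inj pr"
begin

lemma goedel_Suc: "r < R \<Longrightarrow> goedel pr R (s(r := Suc (s r))) = pr r * goedel pr R s"
proof -
  assume r: "r < R"
  have "goedel pr R u = pr r ^ u r * (\<Prod>i\<in>{..<R} - {r}. pr i ^ u i)" for u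
    unfolding goedel_def using r by (subst prod.remove[of _ r]) auto
  then show ?thesis by simp
qed

lemma goedel_add: "r < R \<Longrightarrow> goedel pr R (s(r := s r + k)) = pr r ^ k * goedel pr R s"
proof (induction k)
  case (Suc k)
  then have "goedel pr R (s(r := s r + Suc k)) = pr r * goedel pr R (s(r := s r + k))"
    using goedel_Suc[of r "s(r := s r + k)"] by simp
  with Suc show ?case by (simp only: power_Suc mult.assoc)
qed simp

text \<open>Unique factorisation: a prime dividing the product is one of the bases with positive
  exponent, and distinct registers have distinct primes.\<close>

lemma dvd_goedel_iff: "r < R \<Longrightarrow> pr r dvd goedel pr R s \<longleftrightarrow> s r > 0"
proof
  assume "r < R" "pr r dvd goedel pr R s"
  then obtain i where i: "i < R" "pr r dvd pr i ^ s i"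
    unfolding goedel_def using prime_pr by (auto simp: prime_dvd_prod_iff)
  then have "pr r dvd pr i" "s i > 0"
    using prime_pr[of r] by (auto dest: prime_dvd_power intro!: gr0I)
  then have "r = i" using prime_pr inj_pr by (metis injD primes_dvd_imp_eq)
  with \<open>s i > 0\<close> show "s r > 0" by simp
next
  assume r: "r < R" "s r > 0"
  then have "goedel pr R s = pr r * goedel pr R (s(r := s r - 1))"
    using goedel_Suc[of r "s(r := s r - 1)"] by simp
  then show "pr r dvd goedel pr R s" by simp
qed

lemma csem_goedel_op:
  assumes "rop_reg a < R"
  shows "csem (goedel_op pr a) `` {(goedel pr R s, 0)} = (\<lambda>s. (goedel pr R s, 0)) ` (rop_sem a `` {s})"
proof (cases a)
  case (Inc r)
  then show ?thesis using assms by (simp add: csem_scale rop_sem_Image goedel_Suc del: rop_sem.simps)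
next
  case (Dec r)
  have pos: "pr r > 0" using prime_pr by (simp add: prime_gt_0_nat)
  show ?thesis
  proof (cases "s r > 0")
    case True
    then have "goedel pr R s = pr r * goedel pr R (s(r := s r - 1))"
      using goedel_Suc[of r "s(r := s r - 1)"] assms Dec by simp
    then show ?thesis using True pos Dec by (simp add: csem_scale rop_sem_Image del: rop_sem.simps)
  next
    case False
    with Dec assms pos show ?thesis
      by (simp add: csem_scale rop_sem_Image dvd_goedel_iff del: rop_sem.simps)
  qed
next
  case (Zero r)
  have "pr r > 1" by (rule prime_gt_1_nat[OF prime_pr])
  with Zero assms show ?thesis
    by (cases "s r = 0") (simp_all add: csem_nondvd rop_sem_Image dvd_goedel_iff del: rop_sem.simps)
qed

end

section \<open>From programs to machines\<close>

text \<open>A continuation is the list of programs still to be run. Only finitely many continuations are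
  reachable from a given program, so they can serve as the control states of a machine.\<close>

inductive pstep :: "'o prog list \<Rightarrow> 'o option \<Rightarrow> 'o prog list \<Rightarrow> bool" where
  "pstep (Op a # K) (Some a) K"
| "pstep (Seq P Q # K) None (P # Q # K)"
| "pstep (Alt P Q # K) None (P # K)"
| "pstep (Alt P Q # K) None (Q # K)"
| "pstep (Star P # K) None K"
| "pstep (Star P # K) None (P # Star P # K)"

inductive_cases pstep_elims: "pstep (P # K) a K'" "pstep [] a K'"

text \<open>Structural recursion makes finiteness immediate. \<open>Star P # K\<close> needs no
  mention in the last clause: it is where the body \<open>P\<close> exits, and so lies in
  \<open>conts P (Star P # K)\<close>.\<close>

primrec conts :: "'o prog \<Rightarrow> 'o prog list \<Rightarrow> 'o prog list set" where
  "conts (Op a) K = {Op a # K, K}"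
| "conts (Seq P Q) K = {Seq P Q # K} \<union> conts P (Q # K) \<union> conts Q K"
| "conts (Alt P Q) K = {Alt P Q # K} \<union> conts P K \<union> conts Q K"
| "conts (Star P) K = {K} \<union> conts P (Star P # K)"

lemma finite_conts: "finite (conts P K)"
  by (induction P arbitrary: K) auto

lemma conts_ends: "P # K \<in> conts P K \<and> K \<in> conts P K"
proof (induction P arbitrary: K)
  case (Star P)
  then show ?case by auto
qed auto

text \<open>A step can leave the set only by running on into \<open>K\<close>. For
  \<open>K = []\<close> no such step exists, so the set is closed.\<close>

lemma pstep_conts: "pstep L a L' \<Longrightarrow> L \<in> conts P K \<Longrightarrow> L = K \<or> L' \<in> conts P K"
proof (induction P arbitrary: K)
  case (Op b)
  then show ?case by (auto elim: pstep_elims)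
next
  case (Seq P Q)
  from Seq.prems(2) consider "L = Seq P Q # K" | "L \<in> conts P (Q # K)" | "L \<in> conts Q K" by auto
  then show ?case
  proof cases
    case 1
    with Seq.prems(1) show ?thesis using conts_ends[of P "Q # K"] by (auto elim: pstep_elims)
  next
    case 2
    with Seq.IH(1) Seq.prems(1) have "L = Q # K \<or> L' \<in> conts P (Q # K)" by blast
    then show ?thesis using Seq.IH(2)[OF Seq.prems(1)] conts_ends[of Q K] by auto
  next
    case 3
    then show ?thesis using Seq.IH(2)[OF Seq.prems(1)] by auto
  qed
next
  case (Alt P Q)
  from Alt.prems(2) consider "L = Alt P Q # K" | "L \<in> conts P K" | "L \<in> conts Q K" by auto
  then show ?case
  proof cases
    case 1
    with Alt.prems(1) show ?thesis
      using conts_ends[of P K] conts_ends[of Q K] by (auto elim: pstep_elims)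
  qed (use Alt.IH Alt.prems(1) in auto)
next
  case (Star P)
  have K: "L' \<in> conts (Star P) K" if "L = Star P # K"
    using Star.prems(1) that conts_ends[of P "Star P # K"] by (auto elim: pstep_elims)
  from Star.prems(2) consider "L = K" | "L \<in> conts P (Star P # K)" by auto
  then show ?case
  proof cases
    case 2
    with Star.IH Star.prems(1) have "L = Star P # K \<or> L' \<in> conts P (Star P # K)" by blast
    with K show ?thesis by auto
  qed simp
qed

definition cstep :: "('o \<Rightarrow> 's rel) \<Rightarrow> ('o prog list \<times> 's) rel" where
  "cstep I = {((K, s), (K', s')) | K s K' s'. \<exists>a. pstep K a K' \<and>
     (case a of None \<Rightarrow> s' = s | Some a \<Rightarrow> (s, s') \<in> I a)}"

primrec sems :: "('o \<Rightarrow> 's rel) \<Rightarrow> 'o prog list \<Rightarrow> 's rel" where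
  "sems I [] = Id"
| "sems I (P # K) = sem I P O sems I K"

lemma cstep_sems:
  assumes "((K, s), (K', s')) \<in> cstep I" "(s', t) \<in> sems I K'"
  shows "(s, t) \<in> sems I K"
proof -
  from assms(1) obtain a where "pstep K a K'" and a: "case a of None \<Rightarrow> s' = s | Some a \<Rightarrow> (s, s') \<in> I a"
    by (auto simp: cstep_def)
  from this(1) show ?thesis
    using a assms(2)
    by cases (auto intro: converse_rtrancl_into_rtrancl)
qed

lemma cstep_rtrancl_sound:
  assumes "((K, s), (K', s')) \<in> (cstep I)\<^sup>*" "(s', t) \<in> sems I K'"
  shows "(s, t) \<in> sems I K"
  using assms
proof (induction "(K, s)" arbitrary: K s rule: converse_rtrancl_induct)
  case (step z)
  then show ?case by (cases z) (auto dest: cstep_sems)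
qed auto

lemma cstep_complete:
  "(s, t) \<in> sem I P \<Longrightarrow> ((P # K, s), (K, t)) \<in> (cstep I)\<^sup>*"
proof (induction P arbitrary: s t K)
  case (Op a)
  then show ?case by (intro r_into_rtrancl) (auto simp: cstep_def intro!: exI[of _ "Some a"] pstep.intros)
next
  case (Seq P Q)
  then obtain u where u: "(s, u) \<in> sem I P" "(u, t) \<in> sem I Q" by auto
  have "((Seq P Q # K, s), (P # Q # K, s)) \<in> cstep I"
    by (auto simp: cstep_def intro!: exI[of _ None] pstep.intros)
  also note Seq.IH(1)[OF u(1)]
  also note Seq.IH(2)[OF u(2)]
  finally show ?case .
next
  case (Alt P Q)
  have 1: "((Alt P Q # K, s), (P # K, s)) \<in> cstep I" and 2: "((Alt P Q # K, s), (Q # K, s)) \<in> cstep I"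
    by (auto simp: cstep_def intro!: exI[of _ None] pstep.intros)
  from Alt.prems show ?case
    using Alt.IH 1 2 by (auto intro: converse_rtrancl_into_rtrancl)
next
  case (Star P)
  have 1: "((Star P # K, s), (K, s)) \<in> cstep I"
    and 2: "((Star P # K, s), (P # Star P # K, s)) \<in> cstep I" for s
    by (auto simp: cstep_def intro!: exI[of _ None] pstep.intros)
  from Star.prems have "(s, t) \<in> (sem I P)\<^sup>*" by simp
  then show ?case
  proof (induction rule: converse_rtrancl_induct)
    case base
    with 1 show ?case by blast
  next
    case (step s u)
    note 2
    also note Star.IH[OF step(1)]
    also note step(3)
    finally show ?case .
  qed
qed

type_synonym machine = "(nat \<times> cop \<times> nat) list"

definition mstep :: "machine \<Rightarrow> (nat \<times> nat \<times> nat) rel" where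
  "mstep D = {((q, s), (q', s')) | q s q' s'. \<exists>a. (q, a, q') \<in> set D \<and> (s, s') \<in> cop_sem a}"

text \<open>Continuations are numbered and become states; silent steps become \<open>Nop\<close>.
  The final state is nonzero because the empty continuation is not the initial one; later this makes
  the word of a run end in \<open>Fin\<close>.\<close>

lemma machine_of_prog:
  "\<exists>D qf. qf \<noteq> 0 \<and> (\<forall>s t. ((0, s), (qf, t)) \<in> (mstep D)\<^sup>* \<longleftrightarrow> (s, t) \<in> csem P)"
proof -
  define C where "C = conts P []"
  have fin: "finite C" unfolding C_def by (rule finite_conts)
  have mem: "[P] \<in> C" "[] \<in> C" using conts_ends[of P "[]"] by (auto simp: C_def)
  obtain e0 :: "cop prog list \<Rightarrow> nat" where e0: "inj_on e0 C"
    using finite_imp_inj_to_nat_seg[OF fin] by blast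
  define e where "e K = (if K = [P] then 0 else Suc (e0 K))" for K
  have inj: "inj_on e C" using e0 by (auto simp: inj_on_def e_def)
  define lab where "lab = case_option Nop (\<lambda>a::cop. a)"
  define S where "S = {(e K, lab a, e K') | K a K'. K \<in> C \<and> K' \<in> C \<and> pstep K a K'}"
  have "finite S"
  proof (rule finite_subset)
    show "S \<subseteq> e ` C \<times> UNIV \<times> e ` C" by (auto simp: S_def)
    have "(UNIV :: cop set) = {IncA, DecA, ZeroA, IncB, DecB, ZeroB, Nop}"
      using cop.exhaust by blast
    then have "finite (UNIV :: cop set)" by (metis finite.emptyI finite.insertI)
    with fin show "finite (e ` C \<times> (UNIV :: cop set) \<times> e ` C)" by auto
  qed
  then obtain D where D: "set D = S" using finite_list by blast
  have lab: "(s, s') \<in> cop_sem (lab a) \<longleftrightarrow> (case a of None \<Rightarrow> s' = s | Some a \<Rightarrow> (s, s') \<in> cop_sem a)"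
    for s s' a by (auto simp: lab_def split: option.splits)
  have fwd: "K' \<in> C \<and> ((e K, s), (e K', s')) \<in> mstep D"
    if "((K, s), (K', s')) \<in> cstep cop_sem" "K \<in> C" for K s K' s'
  proof -
    from that(1) obtain a where a: "pstep K a K'"
      "case a of None \<Rightarrow> s' = s | Some a \<Rightarrow> (s, s') \<in> cop_sem a" by (auto simp: cstep_def)
    moreover have "K \<noteq> []" using a(1) by (auto elim: pstep_elims)
    ultimately have "K' \<in> C" using pstep_conts that(2) unfolding C_def by blast
    with a that(2) have "(e K, lab a, e K') \<in> set D" unfolding D S_def by blast
    with a \<open>K' \<in> C\<close> show ?thesis unfolding mstep_def lab[symmetric] by blast
  qed
  have bwd: "\<exists>K'\<in>C. q' = e K' \<and> ((K, s), (K', s')) \<in> cstep cop_sem"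
    if "((e K, s), (q', s')) \<in> mstep D" "K \<in> C" for K s q' s'
  proof -
    from that(1) obtain a where a: "(e K, a, q') \<in> S" "(s, s') \<in> cop_sem a"
      by (auto simp: mstep_def D)
    then obtain L b K' where L: "e K = e L" "a = lab b" "q' = e K'" "L \<in> C" "K' \<in> C" "pstep L b K'"
      by (auto simp: S_def)
    then have "L = K" using inj that(2) by (auto dest: inj_onD)
    moreover have "case b of None \<Rightarrow> s' = s | Some a \<Rightarrow> (s, s') \<in> cop_sem a"
      using a(2) L(2) by (simp only: lab)
    ultimately have "((K, s), (K', s')) \<in> cstep cop_sem" using L(6) unfolding cstep_def by blast
    with L show ?thesis by blast
  qed
  have fwds: "K' \<in> C \<and> ((e K, s), (e K', s')) \<in> (mstep D)\<^sup>*"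
    if "((K, s), (K', s')) \<in> (cstep cop_sem)\<^sup>*" "K \<in> C" for K s K' s'
    using that
  proof (induction "(K', s')" arbitrary: K' s' rule: rtrancl_induct)
    case (step z)
    obtain K1 s1 where z: "z = (K1, s1)" by (cases z)
    from step(3)[OF z step(4)] fwd[of K1 s1 K' s'] step(2) z show ?case
      by (auto intro: rtrancl_into_rtrancl)
  qed auto
  have bwds: "\<exists>K'\<in>C. q' = e K' \<and> ((K, s), (K', s')) \<in> (cstep cop_sem)\<^sup>*"
    if "((e K, s), (q', s')) \<in> (mstep D)\<^sup>*" "K \<in> C" for K s q' s'
    using that
  proof (induction "(q', s')" arbitrary: q' s' rule: rtrancl_induct)
    case (step z)
    obtain q1 s1 where z: "z = (q1, s1)" by (cases z)
    from step(3)[OF z step(4)] obtain K1 where K1: "K1 \<in> C" "q1 = e K1"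
      "((K, s), (K1, s1)) \<in> (cstep cop_sem)\<^sup>*" by blast
    then obtain K' where "K' \<in> C" "q' = e K'" "((K1, s1), (K', s')) \<in> cstep cop_sem"
      using bwd[of K1 s1 q' s'] step(2) z by auto
    with K1 show ?case by (auto intro!: bexI[of _ K'] intro: rtrancl_into_rtrancl)
  qed auto
  have e0: "e [P] = 0" by (simp add: e_def)
  have "((0, s), (e [], t)) \<in> (mstep D)\<^sup>* \<longleftrightarrow> (s, t) \<in> csem P" for s t
  proof
    assume "((0, s), (e [], t)) \<in> (mstep D)\<^sup>*"
    then obtain K' where "K' \<in> C" "e [] = e K'" "(([P], s), (K', t)) \<in> (cstep cop_sem)\<^sup>*"
      using bwds[of "[P]" s "e []" t] mem e0 by auto
    moreover from this have "K' = []" using inj mem by (auto dest: inj_onD)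
    ultimately show "(s, t) \<in> csem P" using cstep_rtrancl_sound[of "[P]" s "[]" t cop_sem t] by auto
  next
    assume "(s, t) \<in> csem P"
    then have "(([P], s), ([], t)) \<in> (cstep cop_sem)\<^sup>*" by (rule cstep_complete)
    then show "((0, s), (e [], t)) \<in> (mstep D)\<^sup>*" using fwds[of "[P]" s "[]" t] mem e0 by auto
  qed
  moreover have "e [] \<noteq> 0" by (simp add: e_def)
  ultimately show ?thesis by blast
qed

section \<open>Words encoding runs\<close>

text \<open>Linear conditions on the new counters are what prefix sums can test. That zero cannot be
  decremented is hidden in \<open>a'\<close> and \<open>b'\<close> being natural numbers.\<close>

lemma cop_sem_iff:
  "((a, b), (a', b')) \<in> cop_sem c \<longleftrightarrow>
     int a' = int a + (if c = IncA then 1 else if c = DecA then -1 else 0) \<and>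
     int b' = int b + (if c = IncB then 1 else if c = DecB then -1 else 0) \<and>
     (c = ZeroA \<longrightarrow> a' = 0) \<and> (c = ZeroB \<longrightarrow> b' = 0)"
  by (cases c) auto

text \<open>
  A run of a machine \<open>D\<close> is written as a word whose prefix sums under the weights below hold the
  configuration: \<open>wZ\<close> the control state, \<open>wY\<close> the index in \<open>D\<close> of the transition being taken,
  \<open>wA\<close> and \<open>wB\<close> the counters, and \<open>wP\<close> the phase. In phase 0 the letters \<open>YP\<close>, \<open>YM\<close> move \<open>wY\<close>
  freely; \<open>Do c\<close> executes the selected transition if its source is the current state and enters
  phase 1, where \<open>ZP\<close>, \<open>ZM\<close> move \<open>wZ\<close> while \<open>wY\<close> is frozen; \<open>Fin\<close> checks that the target state has
  been reached and returns to phase 0. States and transition indices are thus written in unary, which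
  keeps the alphabet independent of the machine.

  Only signs of prefix sums are observable, so a comparison with a constant \<open>k\<close> is a comparison with
  \<open>k * wS\<close>, where the start letter \<open>St\<close> is the unit. It also loads the input \<open>N\<close> into the first counter.
\<close>

datatype letter = St | YP | YM | ZP | ZM | Fin | Do cop

type_synonym weight = "letter \<Rightarrow> int"

fun wS :: weight where "wS St = 1" | "wS _ = 0"
fun wR :: weight where "wR St = 0" | "wR _ = 1"
fun wP :: weight where "wP (Do c) = 1" | "wP Fin = - 1" | "wP _ = 0"
fun wY :: weight where "wY YP = 1" | "wY YM = - 1" | "wY _ = 0"
fun wZ :: weight where "wZ ZP = 1" | "wZ ZM = - 1" | "wZ _ = 0"
fun wA :: "nat \<Rightarrow> weight" where
  "wA N St = int N"
| "wA N (Do c) = (if c = IncA then 1 else if c = DecA then - 1 else 0)"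
| "wA N _ = 0"
fun wB :: weight where
  "wB (Do c) = (if c = IncB then 1 else if c = DecB then - 1 else 0)"
| "wB _ = 0"

abbreviation neg :: "weight \<Rightarrow> weight" where "neg F \<equiv> (\<lambda>l. - F l)"
abbreviation geW :: "weight \<Rightarrow> nat \<Rightarrow> weight" where "geW F k \<equiv> (\<lambda>l. F l - int k * wS l)"
abbreviation leW :: "weight \<Rightarrow> nat \<Rightarrow> weight" where "leW F k \<equiv> (\<lambda>l. int k * wS l - F l)"

definition val :: "weight \<Rightarrow> letter list \<Rightarrow> int" where
  "val F u = sum_list (map F u)"

lemma val_simps [simp]:
  "val F [] = 0" "val F (u @ v) = val F u + val F v" "val F [l] = F l" "val F (l # u) = F l + val F u"
  "val (\<lambda>l. - F l) u = - val F u" "val (\<lambda>l. F l - G l) u = val F u - val G u"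
  "val (\<lambda>l. c * F l) u = c * val F u"
  by (simp_all add: val_def uminus_sum_list_map sum_list_subtractf sum_list_const_mult o_def)

text \<open>At the first letter other than \<open>St\<close> the sum of \<open>wR\<close> is 1, so the inequality \<open>wS \<le> wR\<close> required
  there rules out a repeated \<open>St\<close>.\<close>

definition ok_letter :: "nat \<Rightarrow> machine \<Rightarrow> letter \<Rightarrow> (weight \<Rightarrow> bool) \<Rightarrow> bool" where
  "ok_letter N D l P \<longleftrightarrow> (if l = St then P (neg wR) else
     P (\<lambda>l. wR l - wS l) \<and> \<not> P (neg wS) \<and>
     (case l of
        Do c \<Rightarrow> P (leW wP 1) \<and> P (wA N) \<and> P wB \<and> (c = ZeroA \<longrightarrow> P (neg (wA N))) \<and>
          (c = ZeroB \<longrightarrow> P (neg wB)) \<and>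
          (\<exists>j<length D. \<exists>q q'. D ! j = (q, c, q') \<and> P (geW wY j) \<and> P (leW wY j) \<and>
             P (geW wZ q) \<and> P (leW wZ q))
      | Fin \<Rightarrow> P wP \<and> (\<exists>j<length D. \<exists>q c q'. D ! j = (q, c, q') \<and> P (geW wY j) \<and> P (leW wY j) \<and>
             P (geW wZ q') \<and> P (leW wZ q'))
      | ZP \<Rightarrow> P (geW wP 1) | ZM \<Rightarrow> P (geW wP 1)
      | _ \<Rightarrow> P (neg wP)))"

definition final_letter :: "nat \<Rightarrow> letter \<Rightarrow> (weight \<Rightarrow> bool) \<Rightarrow> bool" where
  "final_letter qf l P \<longleftrightarrow> l = Fin \<and> P (neg wP) \<and> P (geW wZ qf) \<and> P (leW wZ qf)"

text \<open>Position \<open>i\<close> sees the prefix including its own letter, as attention does.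
  So \<open>leW wP 1\<close> at \<open>Do c\<close> and \<open>wP\<close> at \<open>Fin\<close> test
  the phase before the letter, but the counters are tested after their change; \<open>wY\<close> and
  \<open>wZ\<close> are constant at both letters.\<close>

definition ok_word :: "nat \<Rightarrow> machine \<Rightarrow> letter list \<Rightarrow> bool" where
  "ok_word N D u \<longleftrightarrow> (\<forall>i<length u. ok_letter N D (u ! i) (\<lambda>F. 0 \<le> val F (take (Suc i) u)))"

definition accepting :: "nat \<Rightarrow> machine \<Rightarrow> nat \<Rightarrow> letter list \<Rightarrow> bool" where
  "accepting N D qf u \<longleftrightarrow> u \<noteq> [] \<and> ok_word N D u \<and> final_letter qf (last u) (\<lambda>F. 0 \<le> val F u)"

lemma ok_word_Nil [simp]: "ok_word N D []"
  by (simp add: ok_word_def)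

lemma ok_word_snoc [simp]:
  "ok_word N D (u @ [l]) \<longleftrightarrow> ok_word N D u \<and> ok_letter N D l (\<lambda>F. 0 \<le> val F u + F l)"
  by (auto simp: ok_word_def less_Suc_eq nth_append)

lemma val_St_only: "set u \<subseteq> {St} \<Longrightarrow> val F u = int (length u) * F St"
  by (induction u) (auto simp: algebra_simps)

lemma val_wR_nonneg: "0 \<le> val wR u"
proof (induction u)
  case (Cons l u)
  then show ?case by (cases l) auto
qed simp

lemma val_wR_pos: "\<not> set u \<subseteq> {St} \<Longrightarrow> 0 < val wR u"
proof (induction u)
  case (Cons l u)
  then show ?case using val_wR_nonneg[of u] by (cases l) auto
qed simp

lemma val_wS_wR: "val wS u + val wR u = int (length u)"
proof (induction u)
  case (Cons l u)
  then show ?case by (cases l) auto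
qed simp

lemma val_wA_le: "val (wA N) u \<le> int N * val wS u + val wR u"
proof (induction u)
  case (Cons l u)
  then show ?case by (cases l) (auto simp: algebra_simps)
qed simp

text \<open>In phase 1 the counters are already updated while \<open>wZ\<close> is still moving, so
  the state is read off as the target of the transition that \<open>wY\<close> holds frozen.\<close>

definition tracks :: "nat \<Rightarrow> machine \<Rightarrow> letter list \<Rightarrow> bool" where
  "tracks N D u \<longleftrightarrow> val wS u = 1 \<and> (\<exists>a b. val (wA N) u = int a \<and> val wB u = int b \<and>
     (val wP u = 0 \<and> (\<exists>q. val wZ u = int q \<and> ((0, N, 0), (q, a, b)) \<in> (mstep D)\<^sup>*) \<or>
      val wP u = 1 \<and> (\<exists>j<length D. val wY u = int j \<and>
        ((0, N, 0), (snd (snd (D ! j)), a, b)) \<in> (mstep D)\<^sup>*)))"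

lemma tracks_snoc:
  assumes u: "tracks N D u" and l: "l \<noteq> St" and ok: "ok_letter N D l (\<lambda>F. 0 \<le> val F u + F l)"
  shows "tracks N D (u @ [l])"
proof -
  from u obtain a b where S: "val wS u = 1" and ab: "val (wA N) u = int a" "val wB u = int b"
    and ph: "val wP u = 0 \<and> (\<exists>q. val wZ u = int q \<and> ((0, N, 0), (q, a, b)) \<in> (mstep D)\<^sup>*) \<or>
      val wP u = 1 \<and> (\<exists>j<length D. val wY u = int j \<and>
        ((0, N, 0), (snd (snd (D ! j)), a, b)) \<in> (mstep D)\<^sup>*)"
    by (auto simp: tracks_def)
  show ?thesis
  proof (cases l)
    case (Do c)
    from ok Do obtain j q q' where j: "j < length D" "D ! j = (q, c, q')" "val wY u = int j"
        "val wZ u = int q"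
      and P: "val wP u \<le> 0" and A: "0 \<le> int a + wA N l" "0 \<le> int b + wB l"
      and Z: "c = ZeroA \<longrightarrow> int a + wA N l \<le> 0" "c = ZeroB \<longrightarrow> int b + wB l \<le> 0"
      by (auto simp: ok_letter_def S ab)
    from ph P j have r: "((0, N, 0), (q, a, b)) \<in> (mstep D)\<^sup>*" and P0: "val wP u = 0" by auto
    define a' b' where "a' = nat (int a + wA N l)" and "b' = nat (int b + wB l)"
    have a': "int a' = int a + wA N l" and b': "int b' = int b + wB l"
      using A by (auto simp: a'_def b'_def)
    have "((a, b), (a', b')) \<in> cop_sem c"
      unfolding cop_sem_iff a' b' using Z a' b' by (auto simp: Do)
    with j have "((q, a, b), (q', a', b')) \<in> mstep D"
      unfolding mstep_def using nth_mem[OF j(1)] by force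
    with r have "((0, N, 0), (q', a', b')) \<in> (mstep D)\<^sup>*" by (rule rtrancl_into_rtrancl)
    moreover have "val wS (u @ [l]) = 1" "val (wA N) (u @ [l]) = int a'" "val wB (u @ [l]) = int b'"
      "val wP (u @ [l]) = 1" "val wY (u @ [l]) = int j"
      unfolding val_simps a' b' using S ab P0 j by (auto simp: Do)
    moreover have "snd (snd (D ! j)) = q'" using j by simp
    ultimately show ?thesis unfolding tracks_def using j(1) by blast
  next
    case Fin
    from ok Fin obtain j q c q' where j: "j < length D" "D ! j = (q, c, q')" "val wY u = int j"
        "val wZ u = int q'" and P: "val wP u \<ge> 1"
      by (auto simp: ok_letter_def S ab)
    with ph show ?thesis
      unfolding tracks_def using S ab Fin by auto
  qed (use ok l S ab ph in \<open>auto simp: tracks_def ok_letter_def\<close>)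
qed

text \<open>Only from the first letter other than \<open>St\<close> on is there a configuration.
  That letter demands a positive \<open>wS\<close> sum of at most 1, so the prefix before it is
  \<open>[St]\<close>; afterwards \<open>neg wR\<close> bars any further \<open>St\<close>.\<close>

lemma ok_word_tracks:
  "ok_word N D u \<Longrightarrow> \<not> set u \<subseteq> {St} \<Longrightarrow> tracks N D u"
proof (induction u rule: rev_induct)
  case (snoc l u)
  show ?case
  proof (cases "set u \<subseteq> {St}")
    case False
    then have "tracks N D u" "0 < val wR u" using snoc val_wR_pos by auto
    with snoc.prems show ?thesis by (intro tracks_snoc) (auto simp: ok_letter_def)
  next
    case True
    then have l: "l \<noteq> St" using snoc.prems by auto
    then have "val wS u + wS l \<le> val wR u + wR l" "0 < val wS u + wS l"
      using snoc.prems by (auto simp: ok_letter_def)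
    then have "length u = 1" using l by (cases l) (auto simp: val_St_only[OF True] le_Suc_eq)
    with True have u: "u = [St]" by (cases u) auto
    have "tracks N D u"
      unfolding tracks_def u by auto
    with l snoc.prems show ?thesis by (intro tracks_snoc) auto
  qed
qed simp

text \<open>The one \<open>St\<close> contributes \<open>N\<close> to the first counter and each of
  the other \<open>length u - 1\<close> letters at most 1.\<close>

lemma accepting_sound:
  assumes "accepting N D qf u"
  obtains a b where "((0, N, 0), (qf, a, b)) \<in> (mstep D)\<^sup>*" "a < N + length u"
proof -
  have "Fin \<in> set u" using assms last_in_set[of u] by (auto simp: accepting_def final_letter_def)
  then have "tracks N D u" using assms by (intro ok_word_tracks) (auto simp: accepting_def)
  then obtain a b q where "val (wA N) u = int a" "val wS u = 1" "val wZ u = int q"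
      and r: "((0, N, 0), (q, a, b)) \<in> (mstep D)\<^sup>*"
    using assms by (auto simp: tracks_def accepting_def final_letter_def)
  moreover from this have "q = qf" using assms by (auto simp: accepting_def final_letter_def)
  ultimately show ?thesis using val_wA_le[of N u] val_wS_wR[of u] by (intro that[of a b]) auto
qed

lemma walk:
  assumes W: "W l = 1" "W m = - 1"
  shows "\<exists>v. set v \<subseteq> {l, m} \<and> val W (u @ v) = y"
proof -
  define k where "k = nat \<bar>y - val W u\<bar>"
  define v where "v = replicate k (if y \<ge> val W u then l else m)"
  have "val W (replicate k x) = int k * W x" for x
    by (induction k) (auto simp: algebra_simps)
  then have "val W (u @ v) = y" using W by (auto simp: v_def k_def)
  then show ?thesis by (intro exI[of _ v]) (auto simp: v_def)
qed

lemma val_unchanged: "(\<And>l. l \<in> set v \<Longrightarrow> F l = 0) \<Longrightarrow> val F v = 0"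
  by (induction v) auto

text \<open>Each machine step appends a walk of \<open>wY\<close>, a \<open>Do c\<close>, a walk of
  \<open>wZ\<close> and a \<open>Fin\<close>. Among the words built, only \<open>[St]\<close> for
  the empty run does not end in \<open>Fin\<close>, and it stays in state 0.\<close>

lemma ok_word_complete:
  assumes "((0, N, 0), (q, a, b)) \<in> (mstep D)\<^sup>*"
  shows "\<exists>u. u \<noteq> [] \<and> ok_word N D u \<and> val wS u = 1 \<and> val wP u = 0 \<and> val wZ u = int q \<and>
    val (wA N) u = int a \<and> val wB u = int b \<and> (q = 0 \<or> last u = Fin)"
  using assms
proof (induction "(q, a, b)" arbitrary: q a b rule: rtrancl_induct)
  case base
  show ?case
    by (rule exI[of _ "[St]"])
      (auto simp: ok_word_def ok_letter_def)
next
  case (step z)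
  obtain q0 a0 b0 where z: "z = (q0, a0, b0)" by (metis prod.exhaust)
  from step(3)[OF z] obtain u where u: "ok_word N D u" "val wS u = 1" "val wP u = 0"
    "val wZ u = int q0" "val (wA N) u = int a0" "val wB u = int b0" by blast
  from step(2) z obtain c where c: "(q0, c, q) \<in> set D" "((a0, b0), (a, b)) \<in> cop_sem c"
    by (auto simp: mstep_def)
  then obtain j where j: "j < length D" "D ! j = (q0, c, q)" by (auto simp: in_set_conv_nth)
  have R: "val wR w \<ge> 0" for w by (rule val_wR_nonneg)
  have ok1: "ok_word N D (u @ v)" if "set v \<subseteq> {YP, YM}" for v
    using that
  proof (induction v rule: rev_induct)
    case (snoc l v)
    have "val wS v = 0" "val wP v = 0"
      by (rule val_unchanged; use snoc.prems in auto)+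
    with snoc u R[of u] R[of v] have "ok_letter N D l (\<lambda>F. 0 \<le> val F (u @ v) + F l)"
      by (auto simp: ok_letter_def)
    then show ?case using snoc ok_word_snoc[of N D "u @ v" l] by simp
  qed (simp add: u)
  obtain v where v: "set v \<subseteq> {YP, YM}" "val wY (u @ v) = int j"
    using walk[of wY YP YM u "int j"] by auto
  have v0: "val wS v = 0" "val wP v = 0" "val wZ v = 0" "val (wA N) v = 0" "val wB v = 0"
    by (rule val_unchanged; use v in auto)+
  define u1 where "u1 = (u @ v) @ [Do c]"
  have ab: "int a = int a0 + wA N (Do c)" "int b = int b0 + wB (Do c)"
    using c(2) unfolding cop_sem_iff by auto
  have "ok_letter N D (Do c) (\<lambda>F. 0 \<le> val F (u @ v) + F (Do c))"
    using u v v0 j R[of u] R[of v] c(2) ab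
    by (auto simp: ok_letter_def cop_sem_iff)
  then have u1: "ok_word N D u1" "val wS u1 = 1" "val wP u1 = 1" "val wZ u1 = int q0"
    "val (wA N) u1 = int a" "val wB u1 = int b" "val wY u1 = int j"
    unfolding u1_def ok_word_snoc using ok1[OF v(1)] u v v0 ab
    by auto
  have ok2: "ok_word N D (u1 @ v)" if "set v \<subseteq> {ZP, ZM}" for v
    using that
  proof (induction v rule: rev_induct)
    case (snoc l v)
    have "val wS v = 0" "val wP v = 0"
      by (rule val_unchanged; use snoc.prems in auto)+
    with snoc u1 R[of u1] R[of v] have "ok_letter N D l (\<lambda>F. 0 \<le> val F (u1 @ v) + F l)"
      by (auto simp: ok_letter_def)
    then show ?case using snoc ok_word_snoc[of N D "u1 @ v" l] by simp
  qed (simp add: u1)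
  obtain x where x: "set x \<subseteq> {ZP, ZM}" "val wZ (u1 @ x) = int q"
    using walk[of wZ ZP ZM u1 "int q"] by auto
  have x0: "val wS x = 0" "val wP x = 0" "val wY x = 0" "val (wA N) x = 0" "val wB x = 0"
    by (rule val_unchanged; use x in auto)+
  have "ok_letter N D Fin (\<lambda>F. 0 \<le> val F (u1 @ x) + F Fin)"
    using u1 x x0 j R[of u1] R[of x] by (auto simp: ok_letter_def)
  then have "ok_word N D ((u1 @ x) @ [Fin])"
    unfolding ok_word_snoc using ok2[OF x(1)] by simp
  then show ?case
    using u1 x x0 by (intro exI[of _ "(u1 @ x) @ [Fin]"]) auto
qed

lemma accepting_complete:
  assumes "((0, N, 0), (qf, a, b)) \<in> (mstep D)\<^sup>*" "qf \<noteq> 0"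
  shows "\<exists>u. accepting N D qf u"
  using ok_word_complete[OF assms(1)] assms(2) by (auto simp: accepting_def final_letter_def)

text \<open>All tests that the conditions on letters can make when \<open>M\<close> exceeds the
  indices and states compared; each becomes one coordinate of the transformer.\<close>

definition weights :: "nat \<Rightarrow> nat \<Rightarrow> weight list" where
  "weights N M = [neg wR, \<lambda>l. wR l - wS l, neg wS, leW wP 1, wA N, wB, neg (wA N), neg wB, wP,
     geW wP 1, neg wP] @
     concat (map (\<lambda>k. [geW wY k, leW wY k, geW wZ k, leW wZ k]) [0..<M])"

lemma length_weights: "length (weights N M) = 11 + 4 * M"
  by (simp add: weights_def length_concat o_def sum_list_triv)

lemma weights_bounded: "F \<in> set (weights N M) \<Longrightarrow> \<bar>F l\<bar> \<le> int (N + M + 1)"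
  by (cases l) (auto simp: weights_def)

definition machine_bound :: "machine \<Rightarrow> nat \<Rightarrow> nat \<Rightarrow> bool" where
  "machine_bound D qf M \<longleftrightarrow> length D \<le> M \<and> qf < M \<and> (\<forall>(q, c, q')\<in>set D. q < M \<and> q' < M)"

lemma ex_machine_bound: "\<exists>M. machine_bound D qf M"
proof -
  let ?S = "insert qf ((\<lambda>(q, c, q'). q) ` set D \<union> (\<lambda>(q, c, q'). q') ` set D)"
  have fin: "finite ?S" by simp
  have "machine_bound D qf (length D + Suc (Max ?S))"
    unfolding machine_bound_def
  proof (intro conjI ballI)
    show "qf < length D + Suc (Max ?S)"
      by (rule trans_less_add2, rule le_imp_less_Suc, rule Max_ge[OF fin]) simp
    fix t assume t: "t \<in> set D"
    obtain q c q' where [simp]: "t = (q, c, q')" by (metis prod.exhaust)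
    have "q \<in> ?S" "q' \<in> ?S" using t by force+
    then have "q \<le> Max ?S" "q' \<le> Max ?S" using Max_ge[OF fin] by blast+
    then show "case t of (q, c, q') \<Rightarrow> q < length D + Suc (Max ?S) \<and> q' < length D + Suc (Max ?S)"
      by auto
  qed auto
  then show ?thesis by blast
qed

text \<open>Every index and state compared is below \<open>M\<close>, so the conditions read
  \<open>P\<close> at listed weights only. They can thus be evaluated from a vector of finitely many
  signs.\<close>

lemma letter_cong:
  assumes M: "machine_bound D qf M" and eq: "\<And>F. F \<in> set (weights N M) \<Longrightarrow> P F = P' F"
  shows "ok_letter N D l P = ok_letter N D l P'" "final_letter qf l P = final_letter qf l P'"
proof -
  have "neg wR \<in> set (weights N M)" "(\<lambda>l. wR l - wS l) \<in> set (weights N M)"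
    "neg wS \<in> set (weights N M)" "leW wP 1 \<in> set (weights N M)" "wA N \<in> set (weights N M)"
    "wB \<in> set (weights N M)" "neg (wA N) \<in> set (weights N M)" "neg wB \<in> set (weights N M)"
    "wP \<in> set (weights N M)" "geW wP 1 \<in> set (weights N M)" "neg wP \<in> set (weights N M)"
    by (simp_all add: weights_def)
  note e = this[THEN eq]
  have "k < M \<Longrightarrow> geW wY k \<in> set (weights N M) \<and> leW wY k \<in> set (weights N M) \<and>
      geW wZ k \<in> set (weights N M) \<and> leW wZ k \<in> set (weights N M)" for k
    unfolding weights_def set_append set_concat set_map set_upt by auto
  then have k: "k < M \<Longrightarrow> P (geW wY k) = P' (geW wY k) \<and> P (leW wY k) = P' (leW wY k) \<and>
      P (geW wZ k) = P' (geW wZ k) \<and> P (leW wZ k) = P' (leW wZ k)" for k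
    using eq by blast
  show "final_letter qf l P = final_letter qf l P'"
    using k[of qf] M e by (auto simp: final_letter_def machine_bound_def)
  have D: "j < M \<and> q < M \<and> q' < M" if "j < length D" "D ! j = (q, c, q')" for j q c q'
    using M that nth_mem[OF that(1)] by (auto simp: machine_bound_def)
  have "(\<exists>j<length D. \<exists>q q'. D ! j = (q, c, q') \<and> P (geW wY j) \<and> P (leW wY j) \<and>
          P (geW wZ q) \<and> P (leW wZ q)) =
        (\<exists>j<length D. \<exists>q q'. D ! j = (q, c, q') \<and> P' (geW wY j) \<and> P' (leW wY j) \<and>
          P' (geW wZ q) \<and> P' (leW wZ q))" for c
    by (intro ex_cong1 conj_cong refl) (use D k in blast)+
  moreover have "(\<exists>j<length D. \<exists>q c q'. D ! j = (q, c, q') \<and> P (geW wY j) \<and> P (leW wY j) \<and>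
          P (geW wZ q') \<and> P (leW wZ q')) =
        (\<exists>j<length D. \<exists>q c q'. D ! j = (q, c, q') \<and> P' (geW wY j) \<and> P' (leW wY j) \<and>
          P' (geW wZ q') \<and> P' (leW wZ q'))"
    by (intro ex_cong1 conj_cong refl) (use D k in blast)+
  ultimately show "ok_letter N D l P = ok_letter N D l P'"
    unfolding ok_letter_def e by (cases l) (simp_all only: letter.case e)
qed

section \<open>Two-layer transformers testing prefix sums\<close>

lemma FF_eq_image:
  "FF p s = (\<lambda>m. of_int m * 2 powr (- of_int s)) ` {- (2 ^ (p - 1)) ..< 2 ^ (p - 1)}"
  by (auto simp: FF_def)

lemma finite_FF: "finite (FF p s)"
  unfolding FF_eq_image by simp

lemma zero_in_FF: "0 \<in> FF p s"
  unfolding FF_def by (auto intro!: exI[of _ 0])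

lemma FF_0_iff: "x \<in> FF p 0 \<longleftrightarrow> (\<exists>m. x = of_int m \<and> - (2 ^ (p - 1)) \<le> m \<and> m < 2 ^ (p - 1))"
  by (auto simp: FF_def)

lemma rnd_in_FF: "rnd p s x \<in> FF p s"
proof (cases "\<exists>y\<in>FF p s. y \<le> x")
  case True
  then have "Max {y \<in> FF p s. y \<le> x} \<in> {y \<in> FF p s. y \<le> x}"
    using finite_FF by (intro Max_in) auto
  with True show ?thesis by (simp add: rnd_def)
next
  case False
  have "Min (FF p s) \<in> FF p s" by (rule Min_in[OF finite_FF]) (use zero_in_FF[of p s] in auto)
  with False show ?thesis by (simp add: rnd_def)
qed

lemma rnd_ident: "x \<in> FF p s \<Longrightarrow> rnd p s x = x"
  unfolding rnd_def using finite_FF by (auto intro!: Max_eqI)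

text \<open>Rounding down cannot cross 0, which is a grid point. Below the range the result is the
  least grid point, which is negative because minus one unit is on the grid for every
  \<open>p\<close>.\<close>

lemma rnd_nonneg_iff: "0 \<le> rnd p s x \<longleftrightarrow> 0 \<le> x"
proof
  assume "0 \<le> x"
  then have 0: "0 \<in> {y \<in> FF p s. y \<le> x}" using zero_in_FF by auto
  then have "0 \<le> Max {y \<in> FF p s. y \<le> x}" using finite_FF by (intro Max_ge) auto
  with 0 show "0 \<le> rnd p s x" by (auto simp: rnd_def)
next
  assume *: "0 \<le> rnd p s x"
  show "0 \<le> x"
  proof (cases "\<exists>y\<in>FF p s. y \<le> x")
    case True
    then have "Max {y \<in> FF p s. y \<le> x} \<in> {y \<in> FF p s. y \<le> x}"
      using finite_FF by (intro Max_in) auto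
    with True * show ?thesis by (auto simp: rnd_def)
  next
    case False
    have "of_int (- 1) * 2 powr (- of_int s) \<in> FF p s"
    proof -
      have "(0::int) < 2 ^ (p - 1)" by simp
      then have "- (2 ^ (p - 1)) \<le> (- 1 :: int) \<and> (- 1 :: int) < 2 ^ (p - 1)" by linarith
      then show ?thesis unfolding FF_def by blast
    qed
    then have "Min (FF p s) \<le> of_int (- 1) * 2 powr (- of_int s)" by (rule Min_le[OF finite_FF])
    also have "\<dots> < 0" by simp
    finally show ?thesis using * False by (simp add: rnd_def)
  qed
qed

lemma FV_eq: "FV p s d = {v. set v \<subseteq> FF p s \<and> length v = d}"
  by (auto simp: FV_def)

lemma finite_FV: "finite (FV p s d)"
  unfolding FV_eq by (rule finite_lists_length_eq[OF finite_FF])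

lemma FV_nth: "v \<in> FV p s d \<Longrightarrow> t < d \<Longrightarrow> v ! t \<in> FF p s"
  by (auto simp: FV_def)

lemma card_FV: "card (FV p s d) \<le> 2 ^ (p * d)" if "p \<ge> 1"
proof -
  have "card (FF p s) \<le> card {- (2 ^ (p - 1)) ..< (2 ^ (p - 1)::int)}"
    unfolding FF_eq_image by (rule card_image_le) simp
  also have "\<dots> = 2 ^ p"
  proof -
    have "(2::int) ^ (p - 1) - - (2 ^ (p - 1)) = 2 ^ p" using that by (cases p) auto
    then show ?thesis by (simp add: nat_power_eq)
  qed
  finally have "card (FF p s) ^ d \<le> (2 ^ p) ^ d" by (rule power_mono) simp
  then show ?thesis
    unfolding FV_eq card_lists_length_eq[OF finite_FF] by (simp add: power_mult)
qed

section \<open>Size of a two-layer transformer\<close>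

declare nat_bits.simps [simp del]

lemma nat_bits_le: "k < 2 ^ b \<Longrightarrow> nat_bits k \<le> b"
proof (induction b arbitrary: k)
  case 0
  then show ?case by (simp add: nat_bits.simps)
next
  case (Suc b)
  then have "nat_bits (k div 2) \<le> b" by (intro Suc.IH) auto
  then show ?case by (subst nat_bits.simps) auto
qed

lemma cbits_le: assumes "x \<in> FF p 0" "p \<ge> 1" shows "cbits 0 x \<le> p + 1"
proof -
  obtain m where m: "x = of_int m" "- (2 ^ (p - 1)) \<le> m" "m < 2 ^ (p - 1)"
    using assms by (auto simp: FF_0_iff)
  have "\<bar>m\<bar> < 2 * 2 ^ (p - 1)"
    using m zero_less_power[of "2::int" "p - 1"] by (simp add: abs_if)
  also have "(2::int) * 2 ^ (p - 1) = 2 ^ p" using assms(2) by (cases p) auto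
  finally have "nat \<bar>m\<bar> < 2 ^ p" by (simp add: nat_less_iff)
  then show ?thesis using nat_bits_le m by (simp add: cbits_def)
qed

text \<open>The summand 2 is the depth, the factor 8 counts four tables in each of two layers,
  \<open>2 ^ (p * d)\<close> bounds the number of vectors and \<open>p + 1\<close> the bits of an
  entry.\<close>

definition size_bound :: "nat \<Rightarrow> nat \<Rightarrow> nat \<Rightarrow> nat" where
  "size_bound n p d = p + d + 2 + n * (d * (p + 1)) + 8 * (2 ^ (p * d) * (d * (p + 1))) +
     2 ^ (p * d) * (p + 1)"

lemma size_bound_mono: "p \<le> p' \<Longrightarrow> d \<le> d' \<Longrightarrow> size_bound n p d \<le> size_bound n p' d'"
  unfolding size_bound_def by (intro add_mono mult_mono power_increasing) auto

lemma table_size_le: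
  assumes "\<And>v. v \<in> FV p 0 d \<Longrightarrow> W v \<in> FV p 0 d" "p \<ge> 1"
  shows "table_size p 0 d W \<le> 2 ^ (p * d) * (d * (p + 1))"
proof -
  have "table_size p 0 d W \<le> (\<Sum>v\<in>FV p 0 d. \<Sum>t<d. p + 1)"
    unfolding table_size_def
    by (intro sum_mono cbits_le FV_nth[OF assms(1)] assms(2)) auto
  also have "\<dots> = card (FV p 0 d) * (d * (p + 1))" by simp
  also have "\<dots> \<le> 2 ^ (p * d) * (d * (p + 1))"
    by (intro mult_right_mono card_FV assms) simp
  finally show ?thesis .
qed

lemma tsize_le:
  assumes wf: "wf_transformer n T" and ts: "ts T = 0" and depth: "depth T = 2"
  shows "tsize n T \<le> size_bound n (tp T) (td T)"
proof -
  let ?p = "tp T" and ?d = "td T"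
  let ?t = "2 ^ (?p * ?d) * (?d * (?p + 1))"
  have p: "?p \<ge> 1" using wf by (simp add: wf_transformer_def)
  obtain L1 L2 where L: "layers T = [L1, L2]"
    using depth by (auto simp: depth_def length_Suc_conv numeral_2_eq_2)
  have tab: "table_size ?p 0 ?d (WQ L) \<le> ?t" "table_size ?p 0 ?d (WK L) \<le> ?t"
    "table_size ?p 0 ?d (WV L) \<le> ?t" "table_size ?p 0 ?d (FN L) \<le> ?t" if "L \<in> {L1, L2}" for L
    by (rule table_size_le[OF _ p]; use wf ts L that in \<open>auto simp: wf_transformer_def\<close>)+
  have "(\<Sum>a<n. \<Sum>t<?d. cbits 0 (emb T a ! t)) \<le> (\<Sum>a<n. \<Sum>t<?d. ?p + 1)"
    by (intro sum_mono cbits_le p) (use wf ts FV_nth in \<open>auto simp: wf_transformer_def\<close>)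
  moreover have "(\<Sum>v\<in>FV ?p 0 ?d. cbits 0 (wout T v)) \<le> (\<Sum>v\<in>FV ?p 0 ?d. ?p + 1)"
    by (intro sum_mono cbits_le p) (use wf ts in \<open>auto simp: wf_transformer_def\<close>)
  moreover have "\<dots> \<le> 2 ^ (?p * ?d) * (?p + 1)"
    using mult_right_mono[OF card_FV[OF p, of 0 ?d], of "?p + 1"] by simp
  ultimately show ?thesis
    unfolding tsize_def size_bound_def ts L depth
    using tab[of L1] tab[of L2] by simp
qed

section \<open>Uniform attention\<close>

lemma length_apply_layer [simp]: "length (apply_layer p s d L hs) = length hs"
  by (simp add: apply_layer_def)

text \<open>Zero queries make every score 0 and every exponential 1, which rounding keeps since 1 is
  on the grid; the denominator is then \<open>Suc i\<close>, never 0.\<close>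

lemma apply_layer_uniform:
  assumes "WQ L (hs ! i) = replicate d 0" "1 \<in> FF p s" "i < length hs"
  shows "apply_layer p s d L hs ! i = FN L (map (\<lambda>t.
    rnd p s (rnd p s ((\<Sum>j\<le>i. WV L (hs ! j) ! t) / real (Suc i)) + hs ! i ! t)) [0..<d])"
proof -
  have "dot (WQ L (hs ! i)) v = 0" for v
    unfolding dot_def assms(1) by (intro sum.neutral) simp
  then have wt: "rnd p s (exp (dot (WQ L (hs ! i)) v)) = 1" for v
    using rnd_ident[OF assms(2)] by simp
  show ?thesis
    using assms(3)
    by (auto simp: apply_layer_def Let_def wt simp del: of_nat_Suc
        intro!: arg_cong[where f = "FN L"] map_cong)
qed

definition depends_on ::
    "(nat \<Rightarrow> int) set \<Rightarrow> (nat \<Rightarrow> ((nat \<Rightarrow> int) \<Rightarrow> bool) \<Rightarrow> bool) \<Rightarrow> bool" where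
  "depends_on A h \<longleftrightarrow> (\<forall>a P P'. (\<forall>f\<in>A. P f = P' f) \<longrightarrow> h a P = h a P')"

lemma depends_onD:
  "depends_on A h \<Longrightarrow> (\<And>f. f \<in> A \<Longrightarrow> P f = P' f) \<Longrightarrow> h a P = h a P'"
  unfolding depends_on_def by metis

context
  fixes n p :: nat and fs :: "(nat \<Rightarrow> int) list"
    and ok fin :: "nat \<Rightarrow> ((nat \<Rightarrow> int) \<Rightarrow> bool) \<Rightarrow> bool"
begin

text \<open>The last coordinate carries the letter (after the first layer, the verdict on the prefix) through
  the residual connection; the others start at zero, so that they receive the bare attention values.\<close>

definition letter_of :: "real list \<Rightarrow> nat" where
  "letter_of v = nat \<lfloor>v ! length fs\<rfloor>"

definition sign_of :: "real list \<Rightarrow> (nat \<Rightarrow> int) \<Rightarrow> bool" where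
  "sign_of v f \<longleftrightarrow> (\<exists>k<length fs. fs ! k = f \<and> 0 \<le> v ! k)"

text \<open>One coordinate serves two purposes: a negative value spoils every later position, a
  positive one counts only at the last.\<close>

definition verdict :: "real list \<Rightarrow> real" where
  "verdict v = (if \<not> ok (letter_of v) (sign_of v) then - 1
     else if fin (letter_of v) (sign_of v) then 1 else 0)"

definition prefix_layer :: layer where
  "prefix_layer = \<lparr>WQ = \<lambda>_. replicate (Suc (length fs)) 0, WK = \<lambda>_. replicate (Suc (length fs)) 0,
     WV = \<lambda>v. map (\<lambda>f. of_int (f (letter_of v))) fs @ [0],
     FN = \<lambda>v. replicate (length fs) 0 @ [verdict v]\<rparr>"

text \<open>Coordinate 0 averages the failures, the last one keeps the verdict of the position
  itself. They are different coordinates as soon as \<open>fs\<close> is nonempty.\<close>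

definition collect_layer :: layer where
  "collect_layer = \<lparr>WQ = \<lambda>_. replicate (Suc (length fs)) 0, WK = \<lambda>_. replicate (Suc (length fs)) 0,
     WV = \<lambda>v. (if v ! length fs < 0 then - 1 else 0) # replicate (length fs) 0, FN = \<lambda>v. v\<rparr>"

definition prefix_transformer :: transformer where
  "prefix_transformer = \<lparr>tp = p, ts = 0, td = Suc (length fs),
     emb = \<lambda>a. replicate (length fs) 0 @ [real a], layers = [prefix_layer, collect_layer],
     wout = \<lambda>v. if 0 \<le> v ! 0 \<and> 0 < v ! length fs then 1 else 0\<rparr>"

context
  assumes p: "p \<ge> 2" and fs: "fs \<noteq> []" and n: "n \<le> 2 ^ (p - 1)"
    and coeff: "\<forall>f\<in>set fs. \<forall>a. - (2 ^ (p - 1)) \<le> f a \<and> f a < 2 ^ (p - 1)"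
    and ok_local: "depends_on (set fs) ok" and fin_local: "depends_on (set fs) fin"
begin

text \<open>One bit would give only the grid \<open>{-1, 0}\<close>; the second one adds 1, needed
  as attention weight and as verdict.\<close>

lemma small_in_FF: "- 1 \<in> FF p 0" "1 \<in> FF p 0"
proof -
  have "(2::int) ^ 1 \<le> 2 ^ (p - 1)" using p by (intro power_increasing) auto
  then show "- 1 \<in> FF p 0" "1 \<in> FF p 0"
    unfolding FF_0_iff by (auto intro: exI[of _ "- 1"] exI[of _ 1])
qed

lemma letter_in_FF: "a < n \<Longrightarrow> real a \<in> FF p 0"
proof -
  assume "a < n"
  with n have "int a < int (2 ^ (p - 1))" by linarith
  then have "int a < 2 ^ (p - 1)" by simp
  moreover have "- (2 ^ (p - 1)) \<le> int a" by (rule order_trans[of _ 0]) auto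
  ultimately show ?thesis unfolding FF_0_iff by (intro exI[of _ "int a"]) auto
qed

lemma verdict_in_FF: "verdict v \<in> FF p 0"
  using small_in_FF zero_in_FF by (simp add: verdict_def)

lemma wf_prefix_transformer: "wf_transformer n prefix_transformer"
proof -
  have "of_int (f a) \<in> FF p 0" if "f \<in> set fs" for f a
    unfolding FF_0_iff using coeff that by blast
  then show ?thesis
    using p letter_in_FF verdict_in_FF small_in_FF zero_in_FF
    by (auto simp: wf_transformer_def prefix_transformer_def prefix_layer_def collect_layer_def FV_def)
qed

lemma lang_prefix_transformer:
  "lang n prefix_transformer = {w. w \<noteq> [] \<and> set w \<subseteq> {..<n} \<and>
     (\<forall>i<length w. ok (w ! i) (\<lambda>f. 0 \<le> sum_list (map f (take (Suc i) w)))) \<and>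
     fin (last w) (\<lambda>f. 0 \<le> sum_list (map f w))}"
proof -
  let ?m = "length fs"
  let ?P = "\<lambda>w i f. 0 \<le> sum_list (map f (take (Suc i) w))"
  have acc: "accepts prefix_transformer w \<longleftrightarrow>
      (\<forall>i<length w. ok (w ! i) (?P w i)) \<and> fin (last w) (\<lambda>f. 0 \<le> sum_list (map f w))"
    if w: "w \<noteq> []" "set w \<subseteq> {..<n}" for w
  proof -
    define h0 where "h0 = map (emb prefix_transformer) w"
    define h1 where "h1 = apply_layer p 0 (Suc ?m) prefix_layer h0"
    define h2 where "h2 = apply_layer p 0 (Suc ?m) collect_layer h1"
    define vd where "vd i = (if \<not> ok (w ! i) (?P w i) then - 1 else if fin (w ! i) (?P w i) then 1
      else 0 :: real)" for i
    have len: "length h0 = length w" "length h1 = length w" "length h2 = length w"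
      by (simp_all add: h0_def h1_def h2_def)
    have h0: "h0 ! i = replicate ?m 0 @ [real (w ! i)]" if "i < length w" for i
      using that by (simp add: h0_def prefix_transformer_def)
    have wn: "real (w ! i) \<in> FF p 0" if "i < length w" for i
      using w nth_mem[OF that] by (intro letter_in_FF) auto
    have h1: "h1 ! i = replicate ?m 0 @ [vd i]" if i: "i < length w" for i
    proof -
      define x where "x = map (\<lambda>t. rnd p 0 (rnd p 0 ((\<Sum>j\<le>i. WV prefix_layer (h0 ! j) ! t) /
        real (Suc i)) + h0 ! i ! t)) [0..<Suc ?m]"
      have 1: "h1 ! i = replicate ?m 0 @ [verdict x]"
        unfolding h1_def
        by (subst apply_layer_uniform) (use i len small_in_FF in \<open>auto simp: prefix_layer_def x_def\<close>)
      have WV: "WV prefix_layer (h0 ! j) = map (\<lambda>f. of_int (f (w ! j))) fs @ [0]" if "j \<le> i" for j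
        using that i h0[of j] by (simp add: prefix_layer_def letter_of_def nth_append)
      \<comment> \<open>The values vanish in this coordinate, so the residual connection delivers
        the letter unchanged.\<close>
      have "x ! ?m = rnd p 0 (rnd p 0 ((\<Sum>j\<le>i. 0) / real (Suc i)) + real (w ! i))"
        using i h0[of i] by (simp add: x_def WV nth_append del: sum.neutral_const)
      then have xm: "x ! ?m = real (w ! i)"
        using rnd_ident[OF zero_in_FF] rnd_ident[OF wn[OF i]] by simp
      \<comment> \<open>The division and both roundings may destroy the magnitude of the sum but
        keep its sign.\<close>
      have xk: "0 \<le> x ! k \<longleftrightarrow> ?P w i (fs ! k)" if k: "k < ?m" for k
      proof -
        have "x ! k = rnd p 0 (rnd p 0 ((\<Sum>j\<le>i. of_int ((fs ! k) (w ! j))) / real (Suc i)) + 0)"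
          using i k h0[of i] by (simp add: x_def WV nth_append)
        then have "0 \<le> x ! k \<longleftrightarrow> 0 \<le> (\<Sum>j\<le>i. of_int ((fs ! k) (w ! j)) :: real)"
          by (simp add: rnd_nonneg_iff zero_le_divide_iff)
        also have "(\<Sum>j\<le>i. of_int ((fs ! k) (w ! j)) :: real) = of_int (\<Sum>j\<le>i. (fs ! k) (w ! j))"
          by simp
        also have "(\<Sum>j\<le>i. (fs ! k) (w ! j)) = sum_list (map (fs ! k) (take (Suc i) w))"
          using i by (auto simp: sum_list_sum_nth atLeast0LessThan lessThan_Suc_atMost intro!: sum.cong)
        finally show ?thesis by simp
      qed
      have sign: "sign_of x f = ?P w i f" if "f \<in> set fs" for f
        using that xk by (auto simp: sign_of_def in_set_conv_nth)
      have "ok (w ! i) (sign_of x) = ok (w ! i) (?P w i)"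
        by (rule depends_onD[OF ok_local sign])
      moreover have "fin (w ! i) (sign_of x) = fin (w ! i) (?P w i)"
        by (rule depends_onD[OF fin_local sign])
      ultimately have "verdict x = vd i"
        unfolding verdict_def vd_def by (simp add: letter_of_def xm)
      with 1 show ?thesis by simp
    qed
    have vdF: "vd i \<in> FF p 0" for i using small_in_FF zero_in_FF by (simp add: vd_def)
    \<comment> \<open>Acceptance reads only the last position, whose attention covers the whole
      word.\<close>
    define i where "i = length w - 1"
    have i: "i < length w" using w by (simp add: i_def)
    define x where "x = map (\<lambda>t. rnd p 0 (rnd p 0 ((\<Sum>j\<le>i. WV collect_layer (h1 ! j) ! t) /
        real (Suc i)) + h1 ! i ! t)) [0..<Suc ?m]"
    have WV: "WV collect_layer (h1 ! j) =
        (if \<not> ok (w ! j) (?P w j) then - 1 else 0) # replicate ?m 0" if "j \<le> i" for j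
      using that i h1[of j] by (simp add: collect_layer_def nth_append vd_def)
    have h2: "h2 ! i = x"
      unfolding h2_def
      by (subst apply_layer_uniform) (use i len small_in_FF in \<open>auto simp: collect_layer_def x_def\<close>)
    have "x ! ?m = rnd p 0 (rnd p 0 ((\<Sum>j\<le>i. 0) / real (Suc i)) + vd i)"
      using i h1[of i] fs by (simp add: x_def WV nth_append nth_Cons' del: sum.neutral_const)
    then have xm: "x ! ?m = vd i"
      using rnd_ident[OF zero_in_FF] rnd_ident[OF vdF] by simp
    have "x ! 0 = rnd p 0 (rnd p 0 ((\<Sum>j\<le>i. if \<not> ok (w ! j) (?P w j) then - 1 else 0) /
        real (Suc i)) + 0)"
      using i h1[of i] fs by (simp add: x_def WV nth_append del: upt_Suc)
    then have "0 \<le> x ! 0 \<longleftrightarrow> 0 \<le> (\<Sum>j\<le>i. if \<not> ok (w ! j) (?P w j) then - 1 else 0 :: real)"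
      by (simp add: rnd_nonneg_iff zero_le_divide_iff)
    \<comment> \<open>No summand is positive, so a single failure makes the sum negative, however
      long the word.\<close>
    also have "\<dots> \<longleftrightarrow> (\<forall>j\<le>i. ok (w ! j) (?P w j))"
    proof
      assume *: "0 \<le> (\<Sum>j\<le>i. if \<not> ok (w ! j) (?P w j) then - 1 else 0 :: real)"
      have "(\<Sum>j\<le>i. if \<not> ok (w ! j) (?P w j) then 1 else 0 :: real) =
          - (\<Sum>j\<le>i. if \<not> ok (w ! j) (?P w j) then - 1 else 0 :: real)"
        unfolding sum_negf[symmetric] by (rule sum.cong) auto
      with * have "(\<Sum>j\<le>i. if \<not> ok (w ! j) (?P w j) then 1 else 0 :: real) = 0"
        by (intro antisym sum_nonneg) auto
      then show "\<forall>j\<le>i. ok (w ! j) (?P w j)"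
        by (subst (asm) sum_nonneg_eq_0_iff) (auto split: if_splits)
    qed simp
    finally have "0 \<le> x ! 0 \<longleftrightarrow> (\<forall>j\<le>i. ok (w ! j) (?P w j))" .
    moreover have "j \<le> i \<longleftrightarrow> j < length w" for j using w by (cases w) (auto simp: i_def)
    ultimately have x0: "0 \<le> x ! 0 \<longleftrightarrow> (\<forall>j<length w. ok (w ! j) (?P w j))" by simp
    have "h2 \<noteq> []" using len w by auto
    then have "last (run prefix_transformer w) = x"
      using h2 len by (simp add: run_def prefix_transformer_def h0_def h1_def h2_def last_conv_nth i_def)
    moreover have "take (Suc i) w = w" "w ! i = last w" using w by (simp_all add: i_def last_conv_nth)
    ultimately show ?thesis
      using w x0 xm i by (auto simp: accepts_def prefix_transformer_def vd_def)
  qed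
  then show ?thesis by (auto simp: lang_def accepts_def)
qed

end

end

section \<open>Length complexity\<close>

text \<open>On \<open>nat\<close> the supremum of an unbounded set is a junk value, so lower bounds on the length complexity
  need the finiteness of the set of languages of transformers of bounded size.\<close>

definition restrict_layer :: "real list set \<Rightarrow> layer \<Rightarrow> layer" where
  "restrict_layer V L = \<lparr>WQ = restrict (WQ L) V, WK = restrict (WK L) V,
     WV = restrict (WV L) V, FN = restrict (FN L) V\<rparr>"

definition restrict_transformer :: "nat \<Rightarrow> transformer \<Rightarrow> transformer" where
  "restrict_transformer n T = (let V = FV (tp T) (ts T) (td T) in
     \<lparr>tp = tp T, ts = ts T, td = td T, emb = restrict (emb T) {..<n},
      layers = map (restrict_layer V) (layers T), wout = restrict (wout T) V\<rparr>)"

lemma rnd_in_FV: "map (\<lambda>t. rnd p s (x t)) [0..<d] \<in> FV p s d"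
  using rnd_in_FF by (auto simp: FV_def)

lemma apply_layer_restrict:
  assumes "set hs \<subseteq> FV p s d"
  shows "apply_layer p s d (restrict_layer (FV p s d) L) hs = apply_layer p s d L hs"
proof -
  have "hs ! j \<in> FV p s d" if "j < length hs" for j using assms that nth_mem by blast
  then show ?thesis
    unfolding apply_layer_def
    by (intro map_cong refl) (auto simp: restrict_layer_def Let_def rnd_in_FV)
qed

lemma apply_layer_in_FV:
  assumes "\<And>v. v \<in> FV p s d \<Longrightarrow> FN L v \<in> FV p s d"
  shows "set (apply_layer p s d L hs) \<subseteq> FV p s d"
  unfolding apply_layer_def Let_def by (auto intro!: assms rnd_in_FV)

lemma foldl_layers_restrict:
  assumes "\<And>L v. L \<in> set Ls \<Longrightarrow> v \<in> FV p s d \<Longrightarrow> FN L v \<in> FV p s d" "set hs \<subseteq> FV p s d"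
  shows "foldl (\<lambda>hs L. apply_layer p s d L hs) hs (map (restrict_layer (FV p s d)) Ls) =
      foldl (\<lambda>hs L. apply_layer p s d L hs) hs Ls \<and>
    set (foldl (\<lambda>hs L. apply_layer p s d L hs) hs Ls) \<subseteq> FV p s d"
  using assms
proof (induction Ls arbitrary: hs)
  case (Cons L Ls)
  then show ?case using apply_layer_in_FV[of p s d L hs] by (simp add: apply_layer_restrict)
qed simp

lemma length_foldl_layers: "length (foldl (\<lambda>hs L. apply_layer p s d L hs) hs Ls) = length hs"
  by (induction Ls arbitrary: hs) auto

lemma lang_restrict_transformer:
  assumes wf: "wf_transformer n T"
  shows "lang n (restrict_transformer n T) = lang n T"
proof -
  let ?V = "FV (tp T) (ts T) (td T)"
  have "accepts (restrict_transformer n T) w = accepts T w" if w: "set w \<subseteq> {..<n}" for w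
  proof (cases "w = []")
    case False
    have emb: "map (emb (restrict_transformer n T)) w = map (emb T) w"
      using w by (auto simp: restrict_transformer_def Let_def)
    have "set (map (emb T) w) \<subseteq> ?V" using wf w by (auto simp: wf_transformer_def)
    moreover have "L \<in> set (layers T) \<Longrightarrow> v \<in> ?V \<Longrightarrow> FN L v \<in> ?V" for L v
      using wf by (auto simp: wf_transformer_def)
    ultimately have run: "run (restrict_transformer n T) w = run T w" "set (run T w) \<subseteq> ?V"
      unfolding run_def emb
      using foldl_layers_restrict[of "layers T" "tp T" "ts T" "td T" "map (emb T) w"]
      by (simp_all add: restrict_transformer_def Let_def)
    have "run T w \<noteq> []" unfolding run_def
      by (metis False length_0_conv length_foldl_layers length_map)
    then have "last (run T w) \<in> ?V" using run(2) last_in_set by blast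
    then show ?thesis
      unfolding accepts_def run(1) by (simp add: restrict_transformer_def Let_def)
  qed (simp add: accepts_def)
  then show ?thesis by (auto simp: lang_def)
qed

text \<open>Values off the grid or beyond the alphabet are arbitrary, so bounded size leaves
  infinitely many transformers. Restriction erases these values and keeps the language, and between
  finite sets there are finitely many extensional functions.\<close>

lemma finite_langs: "finite {lang n T | T. wf_transformer n T \<and> tsize n T \<le> c}"
proof -
  define LS where "LS V = (\<lambda>(a, b, c, d). \<lparr>WQ = a, WK = b, WV = c, FN = d\<rparr>) `
    ((V \<rightarrow>\<^sub>E V) \<times> (V \<rightarrow>\<^sub>E V) \<times> (V \<rightarrow>\<^sub>E V) \<times> (V \<rightarrow>\<^sub>E V))" for V :: "real list set"
  define TS where "TS = (\<Union>p\<in>{..c}. \<Union>s\<in>{- int c..int c}. \<Union>d\<in>{..c}.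
    (\<lambda>(e, ls, w). \<lparr>tp = p, ts = s, td = d, emb = e, layers = ls, wout = w\<rparr>) `
    (({..<n} \<rightarrow>\<^sub>E FV p s d) \<times> {ls. set ls \<subseteq> LS (FV p s d) \<and> length ls \<le> c} \<times>
     (FV p s d \<rightarrow>\<^sub>E FF p s)))"
  have "finite TS"
    unfolding TS_def LS_def
    by (intro finite_UN_I finite_imageI finite_cartesian_product finite_PiE finite_lists_length_le)
       (auto simp: finite_FV finite_FF)
  moreover have "{lang n T | T. wf_transformer n T \<and> tsize n T \<le> c} \<subseteq> lang n ` TS"
  proof safe
    fix T assume wf: "wf_transformer n T" and sz: "tsize n T \<le> c"
    let ?V = "FV (tp T) (ts T) (td T)"
    have "restrict_layer ?V L \<in> LS ?V" if "L \<in> set (layers T)" for L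
    proof -
      have "restrict (WQ L) ?V \<in> ?V \<rightarrow>\<^sub>E ?V" "restrict (WK L) ?V \<in> ?V \<rightarrow>\<^sub>E ?V"
        "restrict (WV L) ?V \<in> ?V \<rightarrow>\<^sub>E ?V" "restrict (FN L) ?V \<in> ?V \<rightarrow>\<^sub>E ?V"
        using wf that by (auto simp: wf_transformer_def)
      then show ?thesis 
        unfolding LS_def restrict_layer_def
        by (intro image_eqI[where x = "(restrict (WQ L) ?V, restrict (WK L) ?V, restrict (WV L) ?V,
              restrict (FN L) ?V)"]) auto
    qed
    moreover have "restrict (emb T) {..<n} \<in> {..<n} \<rightarrow>\<^sub>E ?V" "restrict (wout T) ?V \<in> ?V \<rightarrow>\<^sub>E FF (tp T) (ts T)"
      using wf by (auto simp: wf_transformer_def)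
    moreover have "tp T \<le> c" "ts T \<in> {- int c..int c}" "td T \<le> c" "length (layers T) \<le> c"
      using sz by (auto simp: tsize_def depth_def)
    ultimately have "restrict_transformer n T \<in> TS"
      unfolding TS_def restrict_transformer_def Let_def
      by (intro UN_I[of "tp T"] UN_I[of "ts T"] UN_I[of "td T"]
          image_eqI[where x = "(restrict (emb T) {..<n}, map (restrict_layer ?V) (layers T), restrict (wout T) ?V)"])
         auto
    then show "lang n T \<in> lang n ` TS"
      using lang_restrict_transformer[OF wf] by (metis imageI)
  qed
  ultimately show ?thesis using finite_subset by blast
qed

text \<open>The minimal length depends only on the two languages, so it takes finitely many values
  and \<open>Sup\<close> is a genuine upper bound.\<close>

lemma length_complexity_ge:
  assumes "wf_transformer n T" "wf_transformer n T'" "depth T \<in> D" "depth T' \<in> D"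
    "tsize n T \<le> c" "tsize n T' \<le> c" "lang n T - lang n T' \<noteq> {}"
  shows "(LEAST l. \<exists>w\<in>lang n T - lang n T'. length w = l) \<le> length_complexity n D c"
proof -
  let ?S = "{LEAST l. \<exists>w\<in>lang n T - lang n T'. length w = l | T T'.
        wf_transformer n T \<and> wf_transformer n T' \<and> depth T \<in> D \<and> depth T' \<in> D \<and>
        tsize n T \<le> c \<and> tsize n T' \<le> c \<and> lang n T - lang n T' \<noteq> {}}"
  let ?L = "{lang n T | T. wf_transformer n T \<and> tsize n T \<le> c}"
  have "?S \<subseteq> (\<lambda>(A, B). LEAST l. \<exists>w\<in>A - B. length w = l) ` (?L \<times> ?L)"
    by (auto simp: image_iff)
  then have "finite ?S" by (rule finite_subset) (intro finite_imageI finite_cartesian_product finite_langs)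
  then have "bdd_above ?S" by (rule bdd_above_finite)
  then show ?thesis
    unfolding length_complexity_def by (intro cSup_upper) (use assms in blast)
qed

section \<open>Computability of the size bound\<close>

lemma computable_binary:
  assumes r: "\<And>a b. rec_eval r [a, b] (h a b)" and "computable f" "computable g"
  shows "computable (\<lambda>x. h (f x) (g x))"
proof -
  obtain rf rg where "\<And>x. rec_eval rf [x] (f x)" "\<And>x. rec_eval rg [x] (g x)"
    using assms by (auto simp: computable_def)
  then have "rec_eval (RCn r [rf, rg]) [x] (h (f x) (g x))" for x
    by (intro rec_eval.comp[where ys = "[f x, g x]"]) (auto simp: r)
  then show ?thesis by (auto simp: computable_def)
qed

lemma computable_compose:
  assumes "computable f" "computable g" shows "computable (\<lambda>x. f (g x))"
proof -
  obtain rf rg where "\<And>x. rec_eval rf [x] (f x)" "\<And>x. rec_eval rg [x] (g x)"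
    using assms by (auto simp: computable_def)
  then have "rec_eval (RCn rf [rg]) [x] (f (g x))" for x
    by (intro rec_eval.comp[where ys = "[g x]"]) auto
  then show ?thesis by (auto simp: computable_def)
qed

lemma rec_eval_projI: "i < length xs \<Longrightarrow> y = xs ! i \<Longrightarrow> rec_eval (RId i) xs y"
  using rec_eval.proj by simp

lemma rec_eval_add: "rec_eval (RPr (RId 0) (RCn RS [RId (Suc 0)])) [a, b] (a + b)"
proof (induction a)
  case 0
  then show ?case by (auto intro!: rec_eval.pr0 rec_eval_projI)
next
  case (Suc a)
  have "rec_eval (RCn RS [RId (Suc 0)]) [a, a + b, b] (Suc (a + b))"
    by (rule rec_eval.comp[where ys = "[a + b]"]) (auto intro: rec_eval_projI rec_eval.succ)
  with Suc show ?case by (auto intro: rec_eval.prS)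
qed

lemma rec_eval_mult:
  "rec_eval (RPr RZ (RCn (RPr (RId 0) (RCn RS [RId (Suc 0)])) [RId 2, RId (Suc 0)])) [a, b] (a * b)"
proof (induction a)
  case 0
  then show ?case by (auto intro!: rec_eval.pr0 rec_eval.zero)
next
  case (Suc a)
  have "rec_eval (RCn (RPr (RId 0) (RCn RS [RId (Suc 0)])) [RId 2, RId (Suc 0)]) [a, a * b, b] (b + a * b)"
    by (rule rec_eval.comp[where ys = "[b, a * b]"]) (auto intro: rec_eval_projI intro!: rec_eval_add)
  with Suc show ?case by (auto intro: rec_eval.prS)
qed

lemma computable_pow2: "computable (\<lambda>x. 2 ^ x)"
proof -
  have "rec_eval (RPr (RCn RS [RZ]) (RCn (RPr (RId 0) (RCn RS [RId (Suc 0)])) [RId (Suc 0), RId (Suc 0)])) [x] (2 ^ x)" for x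
  proof (induction x)
    case 0
    have "rec_eval (RCn RS [RZ]) [] 1"
      by (rule rec_eval.comp[where ys = "[0]"]) (auto intro: rec_eval.zero rec_eval.succ[of 0, simplified])
    then show ?case by (auto intro: rec_eval.pr0)
  next
    case (Suc x)
    have "rec_eval (RCn (RPr (RId 0) (RCn RS [RId (Suc 0)])) [RId (Suc 0), RId (Suc 0)]) [x, 2 ^ x] (2 ^ x + 2 ^ x)"
      by (rule rec_eval.comp[where ys = "[2 ^ x, 2 ^ x]"])
        (auto intro: rec_eval_projI intro!: rec_eval_add)
    then have "rec_eval (RCn (RPr (RId 0) (RCn RS [RId (Suc 0)])) [RId (Suc 0), RId (Suc 0)]) [x, 2 ^ x] (2 ^ Suc x)"
      by (simp add: mult_2)
    with Suc show ?case by (rule rec_eval.prS)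
  qed
  then show ?thesis by (auto simp: computable_def)
qed

lemma computable_id: "computable (\<lambda>x. x)"
proof -
  have "rec_eval (RId 0) [x] x" for x by (rule rec_eval_projI) auto
  then show ?thesis by (auto simp: computable_def)
qed

lemma computable_const: "computable (\<lambda>_. k)"
proof (induction k)
  case 0
  then show ?case by (auto simp: computable_def intro: rec_eval.zero)
next
  case (Suc k)
  have "computable Suc" by (auto simp: computable_def intro: rec_eval.succ)
  from computable_compose[OF this Suc] show ?case .
qed

lemma computable_size_bound: "computable (\<lambda>x. size_bound n (x + x * x) x)"
  unfolding size_bound_def
  by (intro computable_binary[OF rec_eval_add] computable_binary[OF rec_eval_mult]
      computable_compose[OF computable_pow2] computable_id computable_const)

section \<open>Diagonalisation\<close>

definition alphabet :: "letter list" where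
  "alphabet = [St, YP, YM, ZP, ZM, Fin, Do IncA, Do DecA, Do ZeroA, Do IncB, Do DecB, Do ZeroB, Do Nop]"

text \<open>Vectors may hold any number as their letter, and coefficients must be bounded at all of
  them; hence the default.\<close>

definition decode :: "nat \<Rightarrow> letter" where
  "decode k = (if k < 13 then alphabet ! k else St)"

lemma ex_decode: "\<exists>k<13. decode k = l"
proof -
  have "l \<in> set alphabet"
    by (cases l) (auto simp: alphabet_def intro: cop.exhaust)
  then obtain k where "k < length alphabet" "alphabet ! k = l" by (auto simp: in_set_conv_nth)
  then show ?thesis by (intro exI[of _ k]) (auto simp: decode_def alphabet_def)
qed

text \<open>\<open>T'\<close> differs from \<open>T\<close> only in never being final, so it has
  empty language and obeys the same size bound. Dimension \<open>12 + 4 * M\<close>: one coordinate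
  per test and one for the letter.\<close>

lemma machine_transformers:
  assumes M: "machine_bound D qf M" and p: "13 \<le> (2::nat) ^ (p - 1)" "N + M + 1 < 2 ^ (p - 1)"
  obtains T T' where "wf_transformer 13 T" "wf_transformer 13 T'" "depth T = 2" "depth T' = 2"
    "tsize 13 T \<le> size_bound 13 p (12 + 4 * M)" "tsize 13 T' \<le> size_bound 13 p (12 + 4 * M)"
    "lang 13 T' = {}" "lang 13 T = {w. set w \<subseteq> {..<13} \<and> accepting N D qf (map decode w)}"
proof -
  define fs where "fs = map (\<lambda>F. F \<circ> decode) (weights N M)"
  define ok where "ok a P = ok_letter N D (decode a) (\<lambda>F. P (F \<circ> decode))"
    for a and P :: "(nat \<Rightarrow> int) \<Rightarrow> bool"
  define fin where "fin a P = final_letter qf (decode a) (\<lambda>F. P (F \<circ> decode))"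
    for a and P :: "(nat \<Rightarrow> int) \<Rightarrow> bool"
  have p2: "p \<ge> 2"
  proof (rule ccontr)
    assume "\<not> p \<ge> 2"
    then have "p - 1 = 0" by simp
    with p(1) show False by simp
  qed
  have len: "length fs = 11 + 4 * M" by (simp add: fs_def length_weights)
  then have ne: "fs \<noteq> []" by auto
  have coeff: "\<forall>f\<in>set fs. \<forall>a. - (2 ^ (p - 1)) \<le> f a \<and> f a < 2 ^ (p - 1)"
  proof (intro ballI allI)
    fix f a assume "f \<in> set fs"
    then have "\<bar>f a\<bar> \<le> int (N + M + 1)" using weights_bounded by (auto simp: fs_def)
    moreover have "int (N + M + 1) < int (2 ^ (p - 1))" using p(2) by (simp only: of_nat_less_iff)
    ultimately show "- (2 ^ (p - 1)) \<le> f a \<and> f a < 2 ^ (p - 1)"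
      unfolding of_nat_power of_nat_numeral by linarith
  qed
  have okc: "depends_on (set fs) ok"
    unfolding depends_on_def ok_def
    by (intro allI impI letter_cong(1)[OF M]) (auto simp: fs_def)
  have finc: "depends_on (set fs) fin"
    unfolding depends_on_def fin_def
    by (intro allI impI letter_cong(2)[OF M, where N = N]) (auto simp: fs_def)
  have finc': "depends_on (set fs) (\<lambda>_ _. False)"
    by (simp add: depends_on_def)
  note wf = wf_prefix_transformer[of p fs 13 ok fin, OF p2 ne p(1) coeff okc finc]
    wf_prefix_transformer[of p fs 13 ok "\<lambda>_ _. False", OF p2 ne p(1) coeff okc finc']
  note L = lang_prefix_transformer[of p fs 13 ok fin, OF p2 ne p(1) coeff okc finc]
  have L': "lang 13 (prefix_transformer p fs ok (\<lambda>_ _. False)) = {}"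
    unfolding lang_prefix_transformer[of p fs 13 ok "\<lambda>_ _. False", OF p2 ne p(1) coeff okc finc']
    by simp
  have sem: "depth (prefix_transformer p fs ok f) = 2" "ts (prefix_transformer p fs ok f) = 0"
    "tp (prefix_transformer p fs ok f) = p" "td (prefix_transformer p fs ok f) = 12 + 4 * M" for f
    by (simp_all add: prefix_transformer_def depth_def len)
  have "sum_list (map (F \<circ> decode) w) = val F (map decode w)" for F w
    by (simp add: val_def)
  then have "lang 13 (prefix_transformer p fs ok fin) =
      {w. set w \<subseteq> {..<13} \<and> accepting N D qf (map decode w)}"
    unfolding L ok_def fin_def
    by (auto simp: accepting_def ok_word_def take_map last_map simp del: map_map)
  with wf L' sem tsize_le[OF wf(1)] tsize_le[OF wf(2)] show ?thesis
    by (intro that[of "prefix_transformer p fs ok fin" "prefix_transformer p fs ok (\<lambda>_ _. False)"])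
      simp_all
qed

lemma length_complexity_exceeds:
  assumes "computable g" "2 \<in> Ds"
  shows "\<exists>c. g c < length_complexity 13 Ds c"
proof -
  define S where "S x = size_bound 13 (x + x * x) x" for x
  have "computable (\<lambda>x. g (S x))"
    unfolding S_def by (rule computable_compose[OF assms(1) computable_size_bound])
  then obtain r where r: "\<And>x. rec_eval r [x] (g (S x))" by (auto simp: computable_def)
  \<comment> \<open>Input in register 0, output in register 1, scratch from 2 on.\<close>
  define P where "P = compile r [0] 1 2"
  have P: "rsem P `` {(\<lambda>_. 0)(0 := x)} = {(\<lambda>_. 0)(0 := x, 1 := g (S x))}" for x
    unfolding P_def by (rule computesD[OF computes_compile]) (use r in auto)
  obtain pr :: "nat \<Rightarrow> nat" where pr: "inj pr" "range pr \<subseteq> {p. prime p}"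
    using infinite_countable_subset[OF primes_infinite] by blast
  then have prime: "prime (pr i)" for i by auto
  obtain R where R: "1 < R" "\<And>a. a \<in> set_prog P \<Longrightarrow> rop_reg a < R"
  proof
    let ?R = "Suc (Suc (Max (rop_reg ` set_prog P)))"
    show "1 < ?R" by simp
    show "rop_reg a < ?R" if "a \<in> set_prog P" for a
    proof -
      have "rop_reg a \<le> Max (rop_reg ` set_prog P)"
        using that by (intro Max_ge finite_imageI finite_set_prog) auto
      then show ?thesis by simp
    qed
  qed
  obtain D qf where D: "qf \<noteq> 0"
    "\<And>s t. ((0, s), (qf, t)) \<in> (mstep D)\<^sup>* \<longleftrightarrow> (s, t) \<in> csem (prog_bind (goedel_op pr) P)"
    using machine_of_prog[of "prog_bind (goedel_op pr) P"] by blast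
  obtain M where M: "machine_bound D qf M" using ex_machine_bound by blast
  \<comment> \<open>Only now, with the machine fixed, is \<open>x\<close> chosen above its dimension
    and the prime \<open>pr 0\<close>.\<close>
  obtain x where x: "pr 0 \<le> x" "12 + 4 * M \<le> x"
    by (meson le_add1 le_add2)
  define N where "N = pr 0 ^ x"
  define y where "y = g (S x)"
  have enc: "goedel pr R ((\<lambda>_. 0)(0 := x)) = N"
    using goedel_add[OF prime pr(1), where r = 0 and R = R and s = "\<lambda>_. 0" and k = x] R by (simp add: N_def goedel_def)
  have enc': "goedel pr R ((\<lambda>_. 0)(0 := x, 1 := y)) = pr 1 ^ y * N"
    using goedel_add[OF prime pr(1), where r = 1 and R = R and s = "(\<lambda>_. 0)(0 := x)" and k = y] R enc by simp
  have "csem (prog_bind (goedel_op pr) P) `` {(goedel pr R ((\<lambda>_. 0)(0 := x)), 0)} =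
      (\<lambda>s. (goedel pr R s, 0)) ` (rsem P `` {(\<lambda>_. 0)(0 := x)})"
    by (rule sem_prog_bind[where enc = "\<lambda>s. (goedel pr R s, 0)"])
       (rule csem_goedel_op[OF prime pr(1) R(2)])
  then have "csem (prog_bind (goedel_op pr) P) `` {(N, 0)} = {(pr 1 ^ y * N, 0)}"
    unfolding P y_def[symmetric] by (simp only: enc enc' image_insert image_empty)
  then have reach: "((0, N, 0), (qf, a, b)) \<in> (mstep D)\<^sup>* \<longleftrightarrow> a = pr 1 ^ y * N \<and> b = 0" for a b
    unfolding D(2) by (auto simp: set_eq_iff)
  have "N \<le> 2 ^ (x * x)"
  proof -
    have "pr 0 \<le> 2 ^ x" using x(1) less_exp[of x] by linarith
    then have "pr 0 ^ x \<le> (2 ^ x) ^ x" by (rule power_mono) simp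
    then show ?thesis by (simp add: N_def power_mult)
  qed
  moreover have "M + 1 < 2 ^ (x * x)"
  proof -
    have "M + 1 < x" using x(2) by simp
    also have "x \<le> x * x" by simp
    also have "\<dots> < 2 ^ (x * x)" by (rule less_exp)
    finally show ?thesis .
  qed
  ultimately have "N + M + 1 < 2 ^ Suc (x * x)" by simp
  \<comment> \<open>Beyond \<open>x * x\<close>, one bit for adding \<open>M + 1\<close> and one for
    the sign suffice; \<open>x\<close> are available.\<close>
  also have "\<dots> \<le> 2 ^ (x + x * x - 1)" by (rule power_increasing) (use x(2) in auto)
  finally have p2: "N + M + 1 < 2 ^ (x + x * x - 1)" .
  have p1: "13 \<le> (2::nat) ^ (x + x * x - 1)"
  proof -
    have "(2::nat) ^ 4 \<le> 2 ^ (x + x * x - 1)" by (rule power_increasing) (use x(2) in auto)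
    then show ?thesis by simp
  qed
  obtain T T' where T: "wf_transformer 13 T" "wf_transformer 13 T'" "depth T = 2" "depth T' = 2"
    "tsize 13 T \<le> size_bound 13 (x + x * x) (12 + 4 * M)"
    "tsize 13 T' \<le> size_bound 13 (x + x * x) (12 + 4 * M)"
    and L: "lang 13 T' = {}" "lang 13 T = {w. set w \<subseteq> {..<13} \<and> accepting N D qf (map decode w)}"
    by (rule machine_transformers[OF M p1 p2])
  have "size_bound 13 (x + x * x) (12 + 4 * M) \<le> S x"
    unfolding S_def by (rule size_bound_mono) (use x in auto)
  then have size: "tsize 13 T \<le> S x" "tsize 13 T' \<le> S x" using T by auto
  obtain u where u: "accepting N D qf u" using accepting_complete[of N qf _ _ D] reach D(1) by blast
  obtain e where e: "e l < 13" "decode (e l) = l" for l using ex_decode by metis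
  have "map e u \<in> lang 13 T - lang 13 T'" using u e by (auto simp: L o_def)
  then have ne: "lang 13 T - lang 13 T' \<noteq> {}" by blast
  have long: "y < length w" if w: "w \<in> lang 13 T" for w
  proof -
    have acc: "accepting N D qf (map decode w)" using w by (simp add: L)
    obtain a b where ab: "((0, N, 0), (qf, a, b)) \<in> (mstep D)\<^sup>*" "a < N + length (map decode w)"
      using accepting_sound[OF acc] by blast
    then have "a = pr 1 ^ y * N" using reach[of a b] by blast
    then have "pr 1 ^ y * N < N + length w" using ab(2) by simp
    \<comment> \<open>Taking away the free initial value \<open>N\<close> leaves at least
      \<open>y * N\<close>, hence at least \<open>y\<close>, to be paid for by letters.\<close>
    moreover have "(y + 1) * N \<le> pr 1 ^ y * N"
    proof (rule mult_right_mono)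
      have "y + 1 \<le> 2 ^ y" using less_exp[of y] by linarith
      also have "\<dots> \<le> pr 1 ^ y" by (rule power_mono[OF prime_ge_2_nat[OF prime]]) simp
      finally show "y + 1 \<le> pr 1 ^ y" .
    qed simp
    moreover have "y \<le> y * N" using prime_gt_0_nat[OF prime, of 0] by (simp add: N_def)
    ultimately show ?thesis unfolding add_mult_distrib by linarith
  qed
  have "\<exists>w\<in>lang 13 T - lang 13 T'. length w = (LEAST l. \<exists>w\<in>lang 13 T - lang 13 T'. length w = l)"
    by (rule LeastI_ex[where P = "\<lambda>l. \<exists>w\<in>lang 13 T - lang 13 T'. length w = l"]) (use ne in blast)
  then have "y < (LEAST l. \<exists>w\<in>lang 13 T - lang 13 T'. length w = l)" using long by force
  also have "\<dots> \<le> length_complexity 13 Ds (S x)"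
    by (rule length_complexity_ge) (use T size ne assms in auto)
  finally show ?thesis unfolding y_def by blast
qed

theorem theorem5p1:
  shows "\<exists>n. \<not> admits_nonasymptotic_length_generalization n UNIV
           \<and> \<not> admits_nonasymptotic_length_generalization n {2}"
proof -
  have "\<not> admits_nonasymptotic_length_generalization 13 Ds" if "2 \<in> Ds" for Ds
    unfolding admits_nonasymptotic_length_generalization_def
    using length_complexity_exceeds[OF _ that] by (meson not_le)
  then show ?thesis by blast
qed

end
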